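(* For every honeycomb toroidal graph $\mathrm{HTG}(m,n,\ell)$ and every integer $L$ with $L\equiv 2\pmod 4$ and $6\le L\le mn$, the graph $\mathrm{HTG}(m,n,\ell)$ contains a cycle of length $L$.
   Context: Honeycomb toroidal graph: let $m\ge 1$ be an integer, $n\ge 4$ an even integer, and $\ell$ an integer with $\ell\equiv m \pmod 2$. The graph $\mathrm{HTG}(m,n,\ell)$ has vertex set $\{u_{i,j}: 0\le i\le m-1,\ j\in\mathbb{Z}_n\}$ (second subscripts are taken modulo $n$; the vertices $u_{i,0},\dots,u_{i,n-1}$ form column $i$) and the following edges: vertical edges $u_{i,j}u_{i,j+1}$ for all $0\le i\le m-1$ and all $j$; flat edges $u_{i,j}u_{i+1,j}$ for $0\le i\le m-2$ and all $j$ with $i+j$ odd; jump edges $u_{m-1,j}u_{0,j+\ell}$ for all $j$ with $j\equiv m\pmod 2$. Only parameters for which this is a simple 3-regular graph are allowed (in particular, when $m=1$ one requires $\ell\not\equiv\pm1\pmod n$). *)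

theory Defs
  imports Main
begin

definition htg_vertices :: "int \<Rightarrow> int \<Rightarrow> (int \<times> int) set" where
  "htg_vertices m n = {(i, j). 0 \<le> i \<and> i < m \<and> 0 \<le> j \<and> j < n}"

definition htg_edge :: "int \<Rightarrow> int \<Rightarrow> int \<Rightarrow> int \<times> int \<Rightarrow> int \<times> int \<Rightarrow> bool" where
  "htg_edge m n l u v \<longleftrightarrow>
     (let (i, j) = u; (i', j') = v in
       \<comment> \<open>vertical edges u_{i,j} u_{i,j+1}\<close>
       (i' = i \<and> j' = (j + 1) mod n) \<or>
       \<comment> \<open>flat edges u_{i,j} u_{i+1,j}, 0 <= i <= m-2, i+j odd\<close>
       (i \<le> m - 2 \<and> i' = i + 1 \<and> j' = j \<and> odd (i + j)) \<or>
       \<comment> \<open>jump edges u_{m-1,j} u_{0,j+l}, j = m (mod 2)\<close>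
       (i = m - 1 \<and> i' = 0 \<and> j mod 2 = m mod 2 \<and> j' = (j + l) mod n))"

definition htg_adj :: "int \<Rightarrow> int \<Rightarrow> int \<Rightarrow> int \<times> int \<Rightarrow> int \<times> int \<Rightarrow> bool" where
  "htg_adj m n l u v \<longleftrightarrow>
     u \<in> htg_vertices m n \<and> v \<in> htg_vertices m n \<and>
     (htg_edge m n l u v \<or> htg_edge m n l v u)"

text \<open>Admissible parameters: m >= 1, n >= 4 even, l = m (mod 2), and the graph is simple
  3-regular, which (for these parameters) fails exactly when m = 1 and l = +-1 (mod n).\<close>
definition htg_params :: "int \<Rightarrow> int \<Rightarrow> int \<Rightarrow> bool" where
  "htg_params m n l \<longleftrightarrow>
     m \<ge> 1 \<and> n \<ge> 4 \<and> even n \<and> l mod 2 = m mod 2 \<and>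
     (m = 1 \<longrightarrow> l mod n \<noteq> 1 \<and> l mod n \<noteq> n - 1)"

definition has_cycle_of_length :: "'a set \<Rightarrow> ('a \<Rightarrow> 'a \<Rightarrow> bool) \<Rightarrow> nat \<Rightarrow> bool" where
  "has_cycle_of_length V E L \<longleftrightarrow> L \<ge> 3 \<and>
     (\<exists>vs. length vs = L \<and> distinct vs \<and> set vs \<subseteq> V \<and>
        (\<forall>k < L. E (vs ! k) (vs ! ((k + 1) mod L))))"

end

theory Submission
  imports Defs
begin

text \<open>A cycle which uses jump edges can be prolonged by inserting two new columns in front of the
  jump edges: each used jump edge is replaced by a U-shaped detour, and the detours cover the two
  columns. So cycles with \<open>m\<close> columns come from cycles with \<open>m - 2\<close> columns and exactly \<open>2 n\<close> fewer
  vertices, down to lengths realised by boundaries of small hexagon chains. The parity of \<open>m n / 2\<close>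
  decides the rest. If it is even, then after exchanging the three edge directions of the brick wall
  the number of columns is even, and nothing else is needed. If it is odd, one needs Hamiltonian
  cycles through a jump edge for a single column, obtained by recursion on \<open>n\<close>, again by exchanging
  directions and inserting columns; and for one column explicit cycles of the other lengths.\<close>

text \<open>The descent by two columns has to stop at two or three columns, and the parity
  distinction comes from there. With two columns the bound \<open>2 * n\<close> is a multiple of 4,
  so the admissible lengths end at \<open>2 * n - 2\<close> and strips of hexagons reach all of
  them. With three columns and \<open>n div 2\<close> odd, the bound \<open>3 * n\<close> is itself
  2 modulo 4, so even the Hamiltonian length is demanded; it is inserted into a Hamiltonian cycle of
  the one-column graph, which therefore must contain a jump edge. An odd number of columns with
  \<open>n div 2\<close> even never enters the descent: the exchange of directions is applied first.
  One length has to be built separately at every stage: \<open>2 * n + 2\<close> would descend to a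
  cycle of length 2.\<close>

section \<open>Consecutive pairs of a list, and cycles as lists\<close>

definition conseq :: "'a list \<Rightarrow> ('a \<times> 'a) set" where
  "conseq xs = set (zip xs (tl xs))"

lemma conseq_Nil [simp]: "conseq [] = {}"
  and conseq_single [simp]: "conseq [x] = {}"
  and conseq_Cons [simp]: "conseq (x # y # zs) = insert (x, y) (conseq (y # zs))"
  by (simp_all add: conseq_def)

lemma conseq_append:
  "xs \<noteq> [] \<Longrightarrow> ys \<noteq> [] \<Longrightarrow>
     conseq (xs @ ys) = conseq xs \<union> conseq ys \<union> {(last xs, hd ys)}"
proof (induction xs rule: induct_list012)
  case (2 x) then show ?case by (cases ys) auto
qed auto

lemma conseq_map: "conseq (map f xs) = map_prod f f ` conseq xs"
  by (induction xs rule: induct_list012) auto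

lemma conseq_rev: "conseq (rev xs) = prod.swap ` conseq xs"
proof (induction xs rule: induct_list012)
  case (3 x y zs)
  have "conseq (rev (x # y # zs)) = insert (y, x) (conseq (rev (y # zs)))"
    using conseq_append[of "rev (y # zs)" "[x]"] by simp
  with 3 show ?case by simp
qed auto

lemma conseq_nth: "conseq xs = {(xs ! k, xs ! Suc k) | k. Suc k < length xs}"
  by (auto simp: conseq_def set_zip nth_tl)

lemma conseq_upto: "conseq [a..b] = {(j, j + 1) | j. a \<le> j \<and> j < b}"
proof -
  have "\<exists>k. (j, j + 1) = ([a..b] ! k, [a..b] ! Suc k) \<and> Suc k < length [a..b]"
    if "a \<le> j" "j < b" for j
    using that by (intro exI[of _ "nat (j - a)"]) auto
  then show ?thesis unfolding conseq_nth by fastforce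
qed

lemma conseq_upt: "conseq [a..<b] = {(j, Suc j) | j. a \<le> j \<and> Suc j < b}"
proof -
  have "\<exists>k. (j, Suc j) = ([a..<b] ! k, [a..<b] ! Suc k) \<and> Suc k < length [a..<b]"
    if "a \<le> j" "Suc j < b" for j
    using that by (intro exI[of _ "j - a"]) auto
  then show ?thesis unfolding conseq_nth by fastforce
qed

lemma conseq_mapE:
  assumes "(x, y) \<in> conseq (map f xs)"
  obtains u v where "x = f u" "y = f v" "(u, v) \<in> conseq xs"
  using assms unfolding conseq_map by auto

definition is_cycle :: "('a \<Rightarrow> 'a \<Rightarrow> bool) \<Rightarrow> 'a list \<Rightarrow> bool" where
  "is_cycle E vs \<longleftrightarrow> distinct vs \<and> 3 \<le> length vs \<and> (\<forall>(u, v) \<in> conseq (vs @ [hd vs]). E u v)"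

lemma is_cycle_iff:
  "is_cycle E vs \<longleftrightarrow> distinct vs \<and> 3 \<le> length vs \<and> (\<forall>u v. (u, v) \<in> conseq (vs @ [hd vs]) \<longrightarrow> E u v)"
  unfolding is_cycle_def by blast

lemma has_cycle_of_length_if_is_cycle:
  assumes "is_cycle E vs" "\<And>u v. E u v \<Longrightarrow> u \<in> V"
  shows "has_cycle_of_length V E (length vs)"
proof -
  let ?ws = "vs @ [hd vs]"
  have len: "length vs \<ge> 3" and dist: "distinct vs" and E: "\<And>u v. (u, v) \<in> conseq ?ws \<Longrightarrow> E u v"
    using assms(1) unfolding is_cycle_def by auto
  have step: "E (vs ! k) (vs ! ((k + 1) mod length vs))" if "k < length vs" for k
  proof -
    have "(?ws ! k, ?ws ! Suc k) \<in> conseq ?ws"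
      using that unfolding conseq_nth by auto
    moreover have "?ws ! k = vs ! k" using that by (simp add: nth_append)
    moreover have "?ws ! Suc k = vs ! ((k + 1) mod length vs)"
    proof (cases "Suc k < length vs")
      case False
      then have "Suc k = length vs" using that by simp
      then show ?thesis using len by (simp add: nth_append hd_conv_nth flip: length_greater_0_conv)
    qed (simp add: nth_append)
    ultimately show ?thesis using E by metis
  qed
  then have "set vs \<subseteq> V"
    using assms(2) by (metis in_set_conv_nth subsetI)
  with len dist step show ?thesis unfolding has_cycle_of_length_def by blast
qed

section \<open>The graph as a quotient of the brick wall\<close>

definition htg_jump :: "int \<Rightarrow> int \<Rightarrow> int \<Rightarrow> int \<times> int \<Rightarrow> int \<times> int \<Rightarrow> bool" where
  "htg_jump m n l u v \<longleftrightarrow>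
     fst u = m - 1 \<and> fst v = 0 \<and> snd u mod 2 = m mod 2 \<and> snd v = (snd u + l) mod n"

definition cycle_uses :: "('a \<Rightarrow> 'a \<Rightarrow> bool) \<Rightarrow> 'a list \<Rightarrow> bool" where
  "cycle_uses E vs \<longleftrightarrow> (\<exists>(u, v) \<in> conseq (vs @ [hd vs]). E u v \<or> E v u)"

definition jump_cycle :: "int \<Rightarrow> int \<Rightarrow> int \<Rightarrow> (int \<times> int) list \<Rightarrow> bool" where
  "jump_cycle m n l vs \<longleftrightarrow> is_cycle (htg_adj m n l) vs \<and> cycle_uses (htg_jump m n l) vs"

text \<open>\<open>HTG(m, n, l)\<close> is the quotient of the infinite brick wall on \<open>\<int> \<times> \<int>\<close> by the lattice
  spanned by \<open>(0, n)\<close> and \<open>(m, - l)\<close>; \<open>htg_red\<close> is the quotient map.\<close>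

definition brick_step :: "int \<times> int \<Rightarrow> int \<times> int \<Rightarrow> bool" where
  "brick_step u v \<longleftrightarrow> (fst v = fst u \<and> snd v = snd u + 1) \<or>
     (fst v = fst u + 1 \<and> snd v = snd u \<and> odd (fst u + snd u))"

definition brick_adj :: "int \<times> int \<Rightarrow> int \<times> int \<Rightarrow> bool" where
  "brick_adj u v \<longleftrightarrow> brick_step u v \<or> brick_step v u"

definition htg_red :: "int \<Rightarrow> int \<Rightarrow> int \<Rightarrow> int \<times> int \<Rightarrow> int \<times> int" where
  "htg_red m n l u = (fst u mod m, (snd u + l * (fst u div m)) mod n)"

lemma htg_adj_sym: "htg_adj m n l u v \<Longrightarrow> htg_adj m n l v u"
  by (auto simp: htg_adj_def)

text \<open>Degenerate graphs are included, because exchanging directions can produce them: two rows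
  only, or one column in which jump edges are parallel to vertical edges.\<close>

locale honeycomb =
  fixes m n l :: int
  assumes m_pos: "m \<ge> 1" and n_pos: "n \<ge> 2" and n_even: "even n"
    and l_parity: "l mod 2 = m mod 2"
begin

lemma htg_red_mem [simp]: "htg_red m n l u \<in> htg_vertices m n"
  using m_pos n_pos by (simp add: htg_red_def htg_vertices_def)

lemma htg_red_ident: "u \<in> htg_vertices m n \<Longrightarrow> htg_red m n l u = u"
  by (cases u) (auto simp: htg_red_def htg_vertices_def)

lemma mod_n_even [simp]: "even (x mod n) \<longleftrightarrow> even x"
  using n_even by (simp add: dvd_mod_iff)

lemma htg_red_flat_inner:
  assumes "i mod m < m - 1"
  shows "(i + 1) mod m = i mod m + 1" "(i + 1) div m = i div m"
proof -
  have i: "i mod m + 1 + m * (i div m) = i + 1" by simp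
  have "0 \<le> i mod m" using m_pos by simp
  with assms have a: "(i mod m + 1) mod m = i mod m + 1" "(i mod m + 1) div m = 0" by auto
  show "(i + 1) mod m = i mod m + 1" using a(1) by (simp add: mod_simps)
  show "(i + 1) div m = i div m"
    using div_mult_self2[of m "i mod m + 1" "i div m"] a(2) m_pos unfolding i by simp
qed

lemma htg_red_flat_outer:
  assumes "i mod m = m - 1"
  shows "(i + 1) mod m = 0" "(i + 1) div m = i div m + 1"
proof -
  have i: "i + 1 = m * (i div m + 1)"
    unfolding distrib_left using assms mult_div_mod_eq[of m i] by linarith
  show "(i + 1) mod m = 0" by (subst i) simp
  show "(i + 1) div m = i div m + 1" using m_pos by (subst i) simp
qed

text \<open>Passing to the next copy of the fundamental domain raises \<open>i div m\<close> by one
  and so shifts the row by \<open>l\<close>: jump edges are the flat edges that leave the last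
  column.\<close>

lemma htg_jump_htg_red:
  assumes "odd (i + j)" "i mod m = m - 1"
  shows "htg_jump m n l (htg_red m n l (i, j)) (htg_red m n l (i + 1, j))"
proof -
  have "even i \<longleftrightarrow> even (m * (i div m) + (m - 1))"
    using assms(2) by (metis mult_div_mod_eq)
  then have "even (j + l * (i div m)) \<longleftrightarrow> even m"
    using assms(1) l_parity by (auto simp: even_iff_mod_2_eq_zero[symmetric] mod2_eq_if split: if_splits)
  then have "(j + l * (i div m)) mod n mod 2 = m mod 2"
    using mod_n_even by (metis mod2_eq_if)
  then show ?thesis
    using assms(2) htg_red_flat_outer[OF assms(2)]
    by (simp add: htg_jump_def htg_red_def algebra_simps mod_simps)
qed

lemma htg_edge_htg_red:
  assumes "brick_step u v"
  shows "htg_edge m n l (htg_red m n l u) (htg_red m n l v)"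
proof -
  obtain i j where u: "u = (i, j)" by fastforce
  consider "v = (i, j + 1)" | "v = (i + 1, j)" "odd (i + j)"
    using assms u by (cases v) (auto simp: brick_step_def)
  then show ?thesis
  proof cases
    case 1
    then show ?thesis by (simp add: u htg_edge_def htg_red_def mod_simps algebra_simps)
  next
    case 2
    consider "i mod m < m - 1" | "i mod m = m - 1"
      using m_pos pos_mod_bound[of m i] by linarith
    then show ?thesis
    proof cases
      case 1
      have "even i \<longleftrightarrow> (even (m * (i div m)) \<longleftrightarrow> even (i mod m))"
        by (metis even_add mult_div_mod_eq)
      then have "odd (i mod m + (j + l * (i div m)) mod n)"
        using 2(2) l_parity by (auto simp: mod2_eq_if split: if_splits)
      then show ?thesis
        using 1 2 htg_red_flat_inner[OF 1] by (simp add: u htg_edge_def htg_red_def)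
    next
      case b: 2
      show ?thesis
        using htg_jump_htg_red[OF 2(2) b] 2(1) u by (auto simp: htg_edge_def htg_jump_def case_prod_beta)
    qed
  qed
qed

lemma htg_adj_htg_red: "brick_adj u v \<Longrightarrow> htg_adj m n l (htg_red m n l u) (htg_red m n l v)"
  unfolding brick_adj_def htg_adj_def using htg_edge_htg_red htg_red_mem by blast

lemma htg_edge_lift:
  assumes "htg_edge m n l u v" "u \<in> htg_vertices m n"
  obtains w where "brick_step u w" "htg_red m n l w = v"
proof -
  obtain i j where u: "u = (i, j)" by fastforce
  have ij: "0 \<le> i" "i < m" "0 \<le> j" "j < n" using assms(2) u by (auto simp: htg_vertices_def)
  consider "v = (i, (j + 1) mod n)" | "i \<le> m - 2" "v = (i + 1, j)" "odd (i + j)"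
    | "i = m - 1" "v = (0, (j + l) mod n)" "j mod 2 = m mod 2"
    using assms(1) u by (cases v) (auto simp: htg_edge_def)
  then show ?thesis
  proof cases
    case 1 then show ?thesis using ij u
      by (intro that[of "(i, j + 1)"]) (auto simp: brick_step_def htg_red_def)
  next
    case 2 then show ?thesis using ij u
      by (intro that[of "(i + 1, j)"]) (auto simp: brick_step_def htg_red_def)
  next
    case 3
    have "odd (m - 1 + j)" using 3(3) by (auto simp: mod2_eq_if split: if_splits)
    with 3 show ?thesis using ij u
      by (intro that[of "(m, j)"]) (auto simp: brick_step_def htg_red_def)
  qed
qed

lemma htg_adj_lift:
  assumes "htg_adj m n l u v"
  obtains u' v' where "brick_step u' v'" "htg_red m n l u' = u" "htg_red m n l v' = v"
    | u' v' where "brick_step v' u'" "htg_red m n l u' = u" "htg_red m n l v' = v"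
  using assms htg_edge_lift htg_red_ident unfolding htg_adj_def by metis

text \<open>The walk need not close up in the brick wall: \<open>w\<close> is only a lattice
  translate of its start.\<close>

lemma cycle_of_brick_walk:
  assumes "distinct (map (htg_red m n l) us)" "length us \<ge> 3"
    "\<And>u v. (u, v) \<in> conseq (us @ [w]) \<Longrightarrow> brick_adj u v" "htg_red m n l w = htg_red m n l (hd us)"
  shows "is_cycle (htg_adj m n l) (map (htg_red m n l) us)"
proof -
  have ne: "us \<noteq> []" using assms(2) by auto
  have eq: "map (htg_red m n l) us @ [hd (map (htg_red m n l) us)] = map (htg_red m n l) (us @ [w])"
    using assms(4) ne by (simp add: hd_map)
  show ?thesis
    unfolding is_cycle_iff eq
  proof (intro conjI allI impI)
    fix x y assume "(x, y) \<in> conseq (map (htg_red m n l) (us @ [w]))"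
    then show "htg_adj m n l x y" using assms(3) htg_adj_htg_red by (elim conseq_mapE) blast
  qed (use assms in simp_all)
qed

lemma jump_cycle_of_brick_walk:
  assumes "distinct (map (htg_red m n l) us)" "length us \<ge> 3"
    "\<And>u v. (u, v) \<in> conseq (us @ [w]) \<Longrightarrow> brick_adj u v" "htg_red m n l w = htg_red m n l (hd us)"
    "((m - 1, j), (m, j)) \<in> conseq (us @ [w])" "odd (m - 1 + j)"
  shows "jump_cycle m n l (map (htg_red m n l) us)"
proof -
  have ne: "us \<noteq> []" using assms(2) by auto
  have eq: "map (htg_red m n l) us @ [hd (map (htg_red m n l) us)] = map (htg_red m n l) (us @ [w])"
    using assms(4) ne by (simp add: hd_map)
  have "(htg_red m n l (m - 1, j), htg_red m n l (m, j)) \<in> conseq (map (htg_red m n l) (us @ [w]))"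
    using assms(5) unfolding conseq_map by force
  moreover have "htg_jump m n l (htg_red m n l (m - 1, j)) (htg_red m n l (m, j))"
    using htg_jump_htg_red[OF assms(6) mod_pos_pos_trivial] m_pos by simp
  ultimately show ?thesis
    using cycle_of_brick_walk[OF assms(1-4)] unfolding jump_cycle_def cycle_uses_def eq by blast
qed

lemma htg_red_eq_iff:
  "htg_red m n l (i, j) = htg_red m n l (i', j') \<longleftrightarrow>
     (\<exists>s. i - i' = m * s \<and> n dvd j - j' + l * s)"
proof
  assume "htg_red m n l (i, j) = htg_red m n l (i', j')"
  then have a: "i mod m = i' mod m" and b: "(j + l * (i div m)) mod n = (j' + l * (i' div m)) mod n"
    by (auto simp: htg_red_def)
  have "i - i' = m * (i div m - i' div m)"
    using a by (metis minus_mod_eq_mult_div mod_eq_dvd_iff mult_div_mod_eq right_diff_distrib add_diff_cancel_right)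
  moreover have "n dvd j - j' + l * (i div m - i' div m)"
    using b by (simp add: mod_eq_dvd_iff algebra_simps)
  ultimately show "\<exists>s. i - i' = m * s \<and> n dvd j - j' + l * s" by blast
next
  assume "\<exists>s. i - i' = m * s \<and> n dvd j - j' + l * s"
  then obtain s where s: "i = i' + m * s" "n dvd j - j' + l * s" by (metis diff_add_cancel add.commute)
  have "i mod m = i' mod m" "i div m = i' div m + s" using m_pos s(1) by auto
  moreover have "(j + l * (i' div m + s)) mod n = (j' + l * (i' div m)) mod n"
    using s(2) by (simp add: mod_eq_dvd_iff algebra_simps)
  ultimately show "htg_red m n l (i, j) = htg_red m n l (i', j')" by (simp add: htg_red_def)
qed

lemma htg_red_inj_window:
  assumes "htg_red m n l (i, j) = htg_red m n l (i', j')" "\<bar>i - i'\<bar> < m" "i = i' \<Longrightarrow> \<bar>j - j'\<bar> < n"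
  shows "i = i' \<and> j = j'"
proof -
  obtain s where s: "i - i' = m * s" "n dvd j - j' + l * s"
    using assms(1) htg_red_eq_iff by blast
  have i: "i - i' = 0" using s(1) assms(2) dvd_imp_le_int[of "i - i'" m] m_pos by fastforce
  with s(1) m_pos have "s = 0" by auto
  with s(2) have "n dvd j - j'" by simp
  with i assms(3) have "j - j' = 0" using dvd_imp_le_int[of "j - j'" n] n_pos by fastforce
  with i show ?thesis by simp
qed

end

text \<open>Edges are lifted to the brick wall, mapped by \<open>T\<close> and projected. One
  direction of \<open>eq\<close> makes the induced map independent of the lift, the other makes it
  injective.\<close>

lemma cycle_transport:
  assumes "honeycomb m n l" "honeycomb m' n' l'"
    and adj: "\<And>u v. brick_step u v \<Longrightarrow> brick_adj (T u) (T v)"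
    and eq: "\<And>u v. htg_red m' n' l' u = htg_red m' n' l' v \<longleftrightarrow> htg_red m n l (T u) = htg_red m n l (T v)"
    and cyc: "is_cycle (htg_adj m' n' l') vs"
  shows "is_cycle (htg_adj m n l) (map (htg_red m n l \<circ> T) vs)"
proof -
  interpret H: honeycomb m n l by fact
  interpret H': honeycomb m' n' l' by fact
  let ?f = "htg_red m n l \<circ> T"
  have f: "htg_adj m n l (?f u) (?f v)" if uv: "htg_adj m' n' l' u v" for u v
  proof -
    have "u \<in> htg_vertices m' n'" "v \<in> htg_vertices m' n'" using uv by (auto simp: htg_adj_def)
    then have uv': "htg_red m' n' l' u = u" "htg_red m' n' l' v = v"
      by (auto intro: H'.htg_red_ident)
    from uv obtain a b where ab: "brick_adj (T a) (T b)" "htg_red m' n' l' a = u" "htg_red m' n' l' b = v"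
      proof (cases rule: H'.htg_adj_lift[OF uv, case_names forward backward])
      case (forward a b)
      with adj that show thesis by blast
    next
      case (backward a b)
      with adj that show thesis unfolding brick_adj_def by blast
    qed
    have "htg_red m n l (T a) = ?f u" "htg_red m n l (T b) = ?f v"
      using ab uv' eq[of a u] eq[of b v] by auto
    with H.htg_adj_htg_red[OF ab(1)] show ?thesis by simp
  qed
  have V: "set vs \<subseteq> htg_vertices m' n'"
  proof
    fix x assume "x \<in> set vs"
    then obtain k where k: "k < length vs" "vs ! k = x" by (metis in_set_conv_nth)
    then have "(x, (vs @ [hd vs]) ! Suc k) \<in> conseq (vs @ [hd vs])"
      unfolding conseq_nth by (auto simp: nth_append intro!: exI[of _ k])
    then show "x \<in> htg_vertices m' n'"
      using cyc unfolding is_cycle_def htg_adj_def by blast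
  qed
  have inj: "inj_on ?f (set vs)"
  proof (rule inj_onI)
    fix u v assume "u \<in> set vs" "v \<in> set vs" "?f u = ?f v"
    then show "u = v" using V eq[of u v] H'.htg_red_ident by (metis comp_apply subsetD)
  qed
  have "vs \<noteq> []" using cyc by (auto simp: is_cycle_iff)
  then have hd: "map ?f vs @ [hd (map ?f vs)] = map ?f (vs @ [hd vs])" by (simp add: hd_map)
  show ?thesis
    unfolding is_cycle_iff hd
  proof (intro conjI allI impI)
    fix x y assume "(x, y) \<in> conseq (map ?f (vs @ [hd vs]))"
    then show "htg_adj m n l x y" using cyc f unfolding is_cycle_iff by (elim conseq_mapE) blast
  qed (use cyc inj in \<open>auto simp: is_cycle_iff distinct_map\<close>)
qed

section \<open>Replacing the edges of a cycle by paths\<close>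

lemma fst_conseq_snoc: "fst ` conseq (xs @ [z]) = set xs"
proof (induction xs)
  case (Cons x xs)
  then show ?case by (cases xs) auto
qed simp

text \<open>Two steps along the cycle would return to the start, which is impossible from length 3
  on. This ensures that no jump edge is replaced twice.\<close>

lemma is_cycle_no_backtrack:
  assumes "is_cycle E vs" "(x, y) \<in> conseq (vs @ [hd vs])" "(y, x) \<in> conseq (vs @ [hd vs])"
  shows False
proof -
  let ?ws = "vs @ [hd vs]"
  have d: "distinct vs" and L: "length vs \<ge> 3" using assms(1) by (auto simp: is_cycle_iff)
  then have ne: "vs \<noteq> []" by auto
  define s where "s k = (if Suc k = length vs then 0 else Suc k)" for k
  have s: "s k < length vs" "?ws ! Suc k = vs ! s k" "?ws ! k = vs ! k" if "k < length vs" for k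
    using that ne by (simp_all add: nth_append hd_conv_nth s_def)
  obtain k where k: "k < length vs" "x = ?ws ! k" "y = ?ws ! Suc k"
    using assms(2) unfolding conseq_nth by auto
  obtain j where j: "j < length vs" "y = ?ws ! j" "x = ?ws ! Suc j"
    using assms(3) unfolding conseq_nth by auto
  have "vs ! k = vs ! s j"
    by (fact trans[OF trans[OF s(3)[OF k(1), symmetric] k(2)[symmetric]] trans[OF j(3) s(2)[OF j(1)]]])
  from iffD1[OF nth_eq_iff_index_eq[OF d k(1) s(1)[OF j(1)]] this] have 1: "k = s j" .
  have "vs ! j = vs ! s k"
    by (fact trans[OF trans[OF s(3)[OF j(1), symmetric] j(2)[symmetric]] trans[OF k(3) s(2)[OF k(1)]]])
  from iffD1[OF nth_eq_iff_index_eq[OF d j(1) s(1)[OF k(1)]] this] have 2: "j = s k" .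
  have "s i = 0 \<and> Suc i = length vs \<or> s i = Suc i" for i by (simp add: s_def)
  from this[of k] this[of j] show False unfolding 1[symmetric] 2[symmetric] using L by linarith
qed

lemma is_cycle_vertices:
  assumes "is_cycle E vs" "\<And>u v. E u v \<Longrightarrow> u \<in> V"
  shows "set vs \<subseteq> V"
  using assms fst_conseq_snoc[of vs "hd vs"] unfolding is_cycle_def by force

text \<open>The last vertex is dropped, so that \<open>vs @ [hd vs]\<close> yields the new cycle
  without its closing repetition.\<close>

fun expand :: "('a \<Rightarrow> 'a \<Rightarrow> 'a list) \<Rightarrow> 'a list \<Rightarrow> 'a list" where
  "expand D (x # y # zs) = x # D x y @ expand D (y # zs)"
| "expand D zs = []"

lemma hd_expand: "ws \<noteq> [] \<Longrightarrow> hd (expand D (ws @ [w])) = hd ws"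
  by (cases ws; cases "tl ws") simp_all

lemma set_expand: "set (expand D ws) = (\<Union>(x, y) \<in> conseq ws. insert x (set (D x y)))"
  by (induction D ws rule: expand.induct) auto

lemma conseq_expand:
  "ws \<noteq> [] \<Longrightarrow> conseq (expand D ws @ [last ws]) = (\<Union>(x, y) \<in> conseq ws. conseq (x # D x y @ [y]))"
proof (induction D ws rule: expand.induct)
  case (1 D x y zs)
  let ?e = "expand D (y # zs) @ [last (y # zs)]"
  have hd: "hd ?e = y" by (cases zs) auto
  have "conseq ((x # D x y) @ ?e) = conseq (x # D x y) \<union> conseq ?e \<union> {(last (x # D x y), y)}"
    using conseq_append[of "x # D x y" ?e] hd by simp
  moreover have "conseq ((x # D x y) @ [y]) = conseq (x # D x y) \<union> {(last (x # D x y), y)}"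
    using conseq_append[of "x # D x y" "[y]"] by simp
  ultimately show ?case using 1 by auto
qed auto

lemma distinct_expand:
  assumes "distinct vs"
    and "\<And>x y. (x, y) \<in> conseq (vs @ [z]) \<Longrightarrow> distinct (D x y) \<and> set (D x y) \<inter> set vs = {}"
    and "\<And>x y x' y'. (x, y) \<in> conseq (vs @ [z]) \<Longrightarrow> (x', y') \<in> conseq (vs @ [z]) \<Longrightarrow> x \<noteq> x' \<Longrightarrow>
      set (D x y) \<inter> set (D x' y') = {}"
  shows "distinct (expand D (vs @ [z]))"
  using assms
proof (induction vs)
  case (Cons x vs)
  obtain y zs where yz: "vs @ [z] = y # zs" by (cases vs) auto
  have c: "conseq ((x # vs) @ [z]) = insert (x, y) (conseq (vs @ [z]))"
    unfolding append_Cons yz by simp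
  have e: "expand D ((x # vs) @ [z]) = x # D x y @ expand D (vs @ [z])"
    unfolding append_Cons yz by simp
  have fs: "a \<in> set vs" if "(a, b) \<in> conseq (vs @ [z])" for a b
    using fst_conseq_snoc[of vs z] that by force
  have sub: "(a, b) \<in> conseq ((x # vs) @ [z])" if "(a, b) \<in> conseq (vs @ [z])" for a b
    using that unfolding c by (rule insertI2)
  have IH: "distinct (expand D (vs @ [z]))"
  proof (rule Cons.IH)
    show "distinct vs" using Cons.prems(1) by simp
  next
    fix a b assume "(a, b) \<in> conseq (vs @ [z])"
    from Cons.prems(2)[OF sub[OF this]] show "distinct (D a b) \<and> set (D a b) \<inter> set vs = {}" by simp
  next
    fix a b a' b' assume "(a, b) \<in> conseq (vs @ [z])" "(a', b') \<in> conseq (vs @ [z])" "a \<noteq> a'"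
    then show "set (D a b) \<inter> set (D a' b') = {}" using Cons.prems(3) sub by blast
  qed
  have xy: "(x, y) \<in> conseq ((x # vs) @ [z])" unfolding c by (rule insertI1)
  have dxy: "distinct (D x y)" "set (D x y) \<inter> set (x # vs) = {}"
    using Cons.prems(2)[OF xy] by simp_all
  have "x \<notin> set (expand D (vs @ [z]))"
  proof
    assume "x \<in> set (expand D (vs @ [z]))"
    then obtain a b where ab: "(a, b) \<in> conseq (vs @ [z])" "x \<in> insert a (set (D a b))"
      unfolding set_expand by blast
    then show False using Cons.prems(1) Cons.prems(2)[OF sub[OF ab(1)]] fs[OF ab(1)] by auto
  qed
  moreover have "set (D x y) \<inter> set (expand D (vs @ [z])) = {}"
  proof -
    have "set (D x y) \<inter> insert a (set (D a b)) = {}" if "(a, b) \<in> conseq (vs @ [z])" for a b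
    proof -
      have "x \<noteq> a" using fs[OF that] Cons.prems(1) by auto
      from Cons.prems(3)[OF xy sub[OF that] this] dxy fs[OF that] show ?thesis by auto
    qed
    then show ?thesis unfolding set_expand by auto
  qed
  ultimately show ?case using IH dxy unfolding e by simp
qed simp

section \<open>Cyclic gaps and the insertion of two columns\<close>

text \<open>Cyclic distance from \<open>r\<close> down to the next row of \<open>P\<close>; it is
  \<open>n\<close> if \<open>P = {r}\<close>.\<close>

definition gap :: "int \<Rightarrow> int set \<Rightarrow> int \<Rightarrow> nat" where
  "gap n P r = (LEAST k. 0 < k \<and> (r - int k) mod n \<in> P)"

definition gap_rows :: "int \<Rightarrow> int set \<Rightarrow> int \<Rightarrow> int set" where
  "gap_rows n P r = (\<lambda>x. (r - int x) mod n) ` {..<gap n P r}"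

context
  fixes n :: int and P :: "int set"
  assumes n: "n > 0" and P: "P \<subseteq> {0..<n}"
begin

lemma gap:
  assumes "r \<in> P"
  shows "0 < gap n P r" "(r - int (gap n P r)) mod n \<in> P" "int (gap n P r) \<le> n"
proof -
  have *: "0 < nat n \<and> (r - int (nat n)) mod n \<in> P"
    using assms n P by auto
  show "0 < gap n P r" "(r - int (gap n P r)) mod n \<in> P"
    unfolding gap_def using LeastI[of "\<lambda>k. 0 < k \<and> (r - int k) mod n \<in> P", OF *] by auto
  show "int (gap n P r) \<le> n"
    unfolding gap_def using Least_le[of "\<lambda>k. 0 < k \<and> (r - int k) mod n \<in> P", OF *] n by linarith
qed

lemma not_mem_if_less_gap: "0 < k \<Longrightarrow> k < gap n P r \<Longrightarrow> (r - int k) mod n \<notin> P"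
  unfolding gap_def using not_less_Least by blast

text \<open>Otherwise the larger of the two offsets would pass over a row of \<open>P\<close> before
  its gap is used up.\<close>

lemma gap_rows_inj:
  assumes "r \<in> P" "r' \<in> P" "x < gap n P r" "x' < gap n P r'"
    "(r - int x) mod n = (r' - int x') mod n"
  shows "r = r' \<and> x = x'"
proof -
  have *: "r = r' \<and> x = x'"
    if "r \<in> P" "r' \<in> P" "x < gap n P r" "x' < gap n P r'" "x \<le> x'"
      "(r - int x) mod n = (r' - int x') mod n" for r r' x x'
  proof -
    have "r mod n = (r' - int (x' - x)) mod n"
      using that(5,6) by (simp add: mod_eq_dvd_iff of_nat_diff algebra_simps)
    moreover have r: "r mod n = r" "r' mod n = r'" using that P by auto
    ultimately have eq: "(r' - int (x' - x)) mod n = r" by simp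
    then have "x' - x = 0"
      using not_mem_if_less_gap[of "x' - x" r'] that by (metis gr0I less_imp_diff_less)
    with eq that(5) r show ?thesis by simp
  qed
  show ?thesis using *[of r r' x x'] *[of r' r x' x] assms by (cases "x \<le> x'") auto
qed

lemma gap_rows_disjoint: "r \<in> P \<Longrightarrow> r' \<in> P \<Longrightarrow> r \<noteq> r' \<Longrightarrow> gap_rows n P r \<inter> gap_rows n P r' = {}"
  unfolding gap_rows_def using gap_rows_inj by blast

lemma gap_rows_cover:
  assumes "P \<noteq> {}"
  shows "(\<Union>r\<in>P. gap_rows n P r) = {0..<n}"
proof
  show "(\<Union>r\<in>P. gap_rows n P r) \<subseteq> {0..<n}" using n by (auto simp: gap_rows_def)
  show "{0..<n} \<subseteq> (\<Union>r\<in>P. gap_rows n P r)"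
  proof
    fix y assume y: "y \<in> {0..<n}"
    obtain p where p: "p \<in> P" using assms by blast
    let ?Q = "\<lambda>x::nat. (y + int x) mod n \<in> P"
    have "(y + int (nat ((p - y) mod n))) mod n = p"
      using p P n by (auto simp: mod_simps)
    then have ex: "?Q (nat ((p - y) mod n))" using p by simp
    \<comment> \<open>Row \<open>y\<close> belongs to the first row of \<open>P\<close> met when
      going up from \<open>y\<close>.\<close>
    define x where "x = (LEAST x. ?Q x)"
    define r where "r = (y + int x) mod n"
    have r: "r \<in> P" unfolding r_def x_def using LeastI[of ?Q, OF ex] .
    have "x < gap n P r"
    proof (rule ccontr)
      assume "\<not> x < gap n P r"
      then have g: "gap n P r \<le> x" by simp
      have "(r - int (gap n P r)) mod n = (y + int (x - gap n P r)) mod n"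
        using g mod_diff_left_eq[of "y + int x" n "int (gap n P r)"]
        unfolding r_def[symmetric] by (simp add: of_nat_diff algebra_simps)
      then have "?Q (x - gap n P r)" using gap(2)[OF r] by metis
      then have "x \<le> x - gap n P r" unfolding x_def by (rule Least_le)
      with g gap(1)[OF r] show False by simp
    qed
    moreover have "(r - int x) mod n = y" using y by (simp add: r_def mod_simps)
    ultimately show "y \<in> (\<Union>r\<in>P. gap_rows n P r)" using r unfolding gap_rows_def by blast
  qed
qed

end

definition detour :: "int \<Rightarrow> int \<Rightarrow> int \<Rightarrow> nat \<Rightarrow> (int \<times> int) list" where
  "detour m n r d = map (\<lambda>x. (m, (r - int x) mod n)) [0..<d] @ map (\<lambda>x. (m + 1, (r - int x) mod n)) (rev [0..<d])"

lemma set_detour: "set (detour m n r d) = {m, m + 1} \<times> (\<lambda>x. (r - int x) mod n) ` {..<d}"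
  by (auto simp: detour_def)

lemma distinct_detour:
  "int d \<le> n \<Longrightarrow> distinct (detour m n r d)"
proof -
  assume d: "int d \<le> n"
  have "inj_on (\<lambda>x. (r - int x) mod n) {..<d}"
  proof (rule inj_onI)
    fix x y assume "x \<in> {..<d}" "y \<in> {..<d}" "(r - int x) mod n = (r - int y) mod n"
    then have "n dvd int y - int x" "\<bar>int y - int x\<bar> < n" using d by (auto simp: mod_eq_dvd_iff)
    then show "x = y" using zdvd_imp_le[of n "\<bar>int y - int x\<bar>"] by auto
  qed
  then show ?thesis
    by (auto simp: detour_def distinct_map inj_on_def)
qed

text \<open>The class of vertical edges that \<open>brick_swap\<close> turns into flat edges. A
  cycle containing one will use a flat edge after the exchange.\<close>

definition black_up :: "int \<Rightarrow> int \<times> int \<Rightarrow> int \<times> int \<Rightarrow> bool" where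
  "black_up n u v \<longleftrightarrow> fst v = fst u \<and> snd v = (snd u + 1) mod n \<and> odd (fst u + snd u)"

lemma conseq_detour:
  assumes "d > 0"
  shows "conseq (u # detour m n r d @ [v]) =
    {(u, (m, r mod n)), ((m, (r - int d + 1) mod n), (m + 1, (r - int d + 1) mod n)), ((m + 1, r mod n), v)}
    \<union> (\<lambda>x. ((m, (r - int x) mod n), (m, (r - int (Suc x)) mod n))) ` {x. Suc x < d}
    \<union> (\<lambda>x. ((m + 1, (r - int (Suc x)) mod n), (m + 1, (r - int x) mod n))) ` {x. Suc x < d}"
proof -
  let ?f = "\<lambda>x. (m, (r - int x) mod n)" and ?g = "\<lambda>x. (m + 1, (r - int x) mod n)"
  have ne: "[0..<d] \<noteq> []" using assms by simp
  have l: "last (map ?f [0..<d]) = (m, (r - int d + 1) mod n)" "hd (map ?g (rev [0..<d])) = (m + 1, (r - int d + 1) mod n)"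
    using assms by (simp_all add: last_map hd_map hd_rev of_nat_diff algebra_simps del: upt_conv_Cons)
  have h: "hd (map ?f [0..<d]) = (m, r mod n)" "last (map ?g (rev [0..<d])) = (m + 1, r mod n)"
    using assms by (simp_all add: last_map hd_map last_rev)
  have pairs: "conseq [0..<d] = (\<lambda>x. (x, Suc x)) ` {x. Suc x < d}"
    unfolding conseq_upt by auto
  have f: "conseq (map ?f [0..<d]) = (\<lambda>x. (?f x, ?f (Suc x))) ` {x. Suc x < d}"
    unfolding conseq_map pairs image_image by simp
  have g: "conseq (map ?g (rev [0..<d])) = (\<lambda>x. (?g (Suc x), ?g x)) ` {x. Suc x < d}"
    unfolding conseq_map conseq_rev pairs image_image by simp
  have eq: "u # detour m n r d @ [v] = [u] @ (map ?f [0..<d] @ (map ?g (rev [0..<d]) @ [v]))"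
    by (simp add: detour_def)
  have 1: "conseq (map ?g (rev [0..<d]) @ [v]) = conseq (map ?g (rev [0..<d])) \<union> {((m + 1, r mod n), v)}"
    using conseq_append[of "map ?g (rev [0..<d])" "[v]"] ne h by simp
  have 2: "conseq (map ?f [0..<d] @ (map ?g (rev [0..<d]) @ [v])) = conseq (map ?f [0..<d]) \<union>
     conseq (map ?g (rev [0..<d]) @ [v]) \<union> {((m, (r - int d + 1) mod n), (m + 1, (r - int d + 1) mod n))}"
    using conseq_append[of "map ?f [0..<d]" "map ?g (rev [0..<d]) @ [v]"] ne l by (simp add: hd_append)
  have 3: "conseq (u # detour m n r d @ [v]) = conseq (map ?f [0..<d] @ (map ?g (rev [0..<d]) @ [v])) \<union> {(u, (m, r mod n))}"
    unfolding eq using conseq_append[of "[u]" "map ?f [0..<d] @ (map ?g (rev [0..<d]) @ [v])"] ne h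
    by (simp add: hd_append)
  show ?thesis unfolding 3 2 1 f g by auto
qed

lemma htg_vertices_iff: "(i, j) \<in> htg_vertices m n \<longleftrightarrow> 0 \<le> i \<and> i < m \<and> 0 \<le> j \<and> j < n"
  by (auto simp: htg_vertices_def)

text \<open>The detour turns around on a flat edge in row \<open>r - d + 1\<close>, which exists
  because \<open>r\<close> has the parity of \<open>m\<close> and \<open>d\<close> is even.\<close>

lemma (in honeycomb) detour_adj:
  assumes r: "0 \<le> r" "r < n" "r mod 2 = m mod 2" and d: "even d" "d > 0"
    and uv: "(u, v) \<in> conseq ((m - 1, r) # detour m n r d @ [(0, (r + l) mod n)])"
  shows "htg_adj (m + 2) n l u v"
proof -
  have down: "htg_edge (m + 2) n l (i, (r - int (Suc x)) mod n) (i, (r - int x) mod n)" for i x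
    by (simp add: htg_edge_def mod_simps algebra_simps)
  have V: "(m - 1, r) \<in> htg_vertices (m + 2) n" "(0, (r + l) mod n) \<in> htg_vertices (m + 2) n"
    "(m, x mod n) \<in> htg_vertices (m + 2) n" "(m + 1, x mod n) \<in> htg_vertices (m + 2) n" for x
    using r m_pos n_pos by (simp_all add: htg_vertices_iff)
  have e1: "htg_edge (m + 2) n l (m - 1, r) (m, r mod n)"
    using r by (auto simp: htg_edge_def mod2_eq_if split: if_splits)
  have e2: "htg_edge (m + 2) n l (m, (r - int d + 1) mod n) (m + 1, (r - int d + 1) mod n)"
    using r d by (auto simp: htg_edge_def mod2_eq_if split: if_splits)
  have e3: "htg_edge (m + 2) n l (m + 1, r mod n) (0, (r + l) mod n)"
    using r by (auto simp: htg_edge_def)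
  show ?thesis
    using uv unfolding conseq_detour[OF d(2)] htg_adj_def
    using V e1 e2 e3 down by auto
qed

lemma htg_edge_insert_columns:
  assumes "htg_edge m n l u v" "\<not> htg_jump m n l u v"
  shows "htg_edge (m + 2) n l u v"
  using assms unfolding htg_edge_def htg_jump_def case_prod_beta Let_def
  by (elim disjE conjE) simp_all

lemma htg_adj_insert_columns:
  assumes "htg_adj m n l u v" "\<not> htg_jump m n l u v" "\<not> htg_jump m n l v u"
  shows "htg_adj (m + 2) n l u v"
proof -
  have "w \<in> htg_vertices (m + 2) n" if "w \<in> htg_vertices m n" for w
    using that by (auto simp: htg_vertices_def)
  then show ?thesis
    using assms htg_edge_insert_columns unfolding htg_adj_def by blast
qed

text \<open>Two columns are inserted in front of the jump edges. The jump edge in row \<open>r\<close> is replaced by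
  a U-shaped detour through the rows of the new columns from \<open>r\<close> down to just above the next
  lower jump edge used by the cycle; these detours partition the two new columns.\<close>

lemma (in honeycomb) insert_columns:
  assumes "jump_cycle m n l vs"
  obtains ws where "jump_cycle (m + 2) n l ws" "cycle_uses (black_up n) ws"
    "int (length ws) = int (length vs) + 2 * n"
proof -
  let ?J = "htg_jump m n l"
  define C where "C = conseq (vs @ [hd vs])"
  have cyc: "is_cycle (htg_adj m n l) vs" using assms by (simp add: jump_cycle_def)
  then have ne: "vs \<noteq> []" and dist: "distinct vs" by (auto simp: is_cycle_iff)
  have adj: "htg_adj m n l u v" if "(u, v) \<in> C" for u v
    using cyc that unfolding is_cycle_iff C_def by blast
  then have vert: "u \<in> htg_vertices m n" "v \<in> htg_vertices m n" if "(u, v) \<in> C" for u v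
    using that unfolding htg_adj_def by blast+
  have V: "set vs \<subseteq> htg_vertices m n"
    using is_cycle_vertices[OF cyc] unfolding htg_adj_def by blast
  \<comment> \<open>Rows of the ends in column \<open>m - 1\<close> of the used jump edges,
    whichever way the cycle traverses them.\<close>
  define P where "P = {snd u | u v. ((u, v) \<in> C \<or> (v, u) \<in> C) \<and> ?J u v}"
  have PI: "snd u \<in> P" if "(u, v) \<in> C \<or> (v, u) \<in> C" "?J u v" for u v
    using that unfolding P_def by blast
  have P: "P \<subseteq> {0..<n}" unfolding P_def using vert by (fastforce simp: htg_vertices_def)
  have P_par: "r mod 2 = m mod 2" if "r \<in> P" for r using that unfolding P_def htg_jump_def by auto
  obtain x0 y0 where xy0: "(x0, y0) \<in> C" "?J x0 y0 \<or> ?J y0 x0"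
    using assms unfolding jump_cycle_def cycle_uses_def C_def by blast
  then have P_ne: "P \<noteq> {}" using PI by blast
  note gap = gap[OF _ P] gap_rows_inj[OF _ P] gap_rows_disjoint[OF _ P] gap_rows_cover[OF _ P P_ne]
  have n0: "n > 0" using n_pos by simp
  have even_gap: "even (gap n P r)" if "r \<in> P" for r
  proof -
    have "(r - int (gap n P r)) mod n mod 2 = r mod 2"
      using P_par[OF that] P_par[OF gap(2)[OF n0 that]] by simp
    then have "even ((r - int (gap n P r)) mod n) \<longleftrightarrow> even r"
      by (simp only: even_iff_mod_2_eq_zero)
    then show ?thesis by (cases "even r") simp_all
  qed
  define D where "D r = detour m n r (gap n P r)" for r
  define F where "F x y = (if ?J x y then D (snd x) else if ?J y x then rev (D (snd y)) else [])" for x y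
  have set_D: "set (D r) = {m, m + 1} \<times> gap_rows n P r" for r
    by (simp add: D_def set_detour gap_rows_def)
  \<comment> \<open>This could fail only for one column, and there the odd \<open>l\<close> changes
    the parity of the row.\<close>
  have J_asym: "\<not> ?J y x" if "?J x y" for x y
  proof
    assume "?J y x"
    with that have "snd x mod 2 = 1" "snd y mod 2 = 1" "l mod 2 = 1" and eq: "snd y = (snd x + l) mod n"
      using l_parity by (auto simp: htg_jump_def)
    then have "odd (snd x)" "odd (snd y)" "odd l" by (simp_all only: odd_iff_mod_2_eq_one)
    then show False unfolding eq by simp
  qed
  have F_cases: "F x y = [] \<and> \<not> ?J x y \<and> \<not> ?J y x \<or>
      (\<exists>r \<in> P. set (F x y) = {m, m + 1} \<times> gap_rows n P r \<and> distinct (F x y) \<and> r \<in> P \<and>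
         (?J x y \<and> r = snd x \<or> ?J y x \<and> r = snd y))" if "(x, y) \<in> C" for x y
  proof -
    have "distinct (D r)" if "r \<in> P" for r
      unfolding D_def using distinct_detour gap(3)[OF n0 that] by blast
    then show ?thesis using that PI[of x y] PI[of y x] unfolding F_def by (auto simp: set_D)
  qed
  have J_eq: "u = u' \<and> v = v'" if "?J u v" "?J u' v'" "snd u = snd u'" for u v u' v'
    using that by (auto simp: htg_jump_def prod_eq_iff)
  define ws where "ws = expand F (vs @ [hd vs])"
  have hd_ws: "hd ws = hd vs" unfolding ws_def using hd_expand[OF ne] .
  have cws: "conseq (ws @ [hd ws]) = (\<Union>(x, y) \<in> C. conseq (x # F x y @ [y]))"
    unfolding hd_ws unfolding ws_def C_def by (rule conseq_expand[of "vs @ [hd vs]" F, unfolded last_snoc]) simp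
  have path: "htg_adj (m + 2) n l u v" if "(x, y) \<in> C \<or> (y, x) \<in> C" "?J x y" "(u, v) \<in> conseq (x # D (snd x) @ [y])"
    for x y u v
  proof -
    have "x = (m - 1, snd x)" "y = (0, (snd x + l) mod n)" using that(2) by (auto simp: htg_jump_def prod_eq_iff)
    with that(3) have *: "(u, v) \<in> conseq ((m - 1, snd x) # detour m n (snd x) (gap n P (snd x)) @ [(0, (snd x + l) mod n)])"
      unfolding D_def by metis
    have r: "snd x \<in> P" using PI that by blast
    with P have "0 \<le> snd x" "snd x < n" by auto
    from detour_adj[OF this P_par[OF r] even_gap[OF r] gap(1)[OF n0 r] *] show ?thesis .
  qed
  have rev_F: "conseq (x # F x y @ [y]) = prod.swap ` conseq (y # D (snd y) @ [x])" if "?J y x" for x y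
  proof -
    have "x # F x y @ [y] = rev (y # D (snd y) @ [x])" using that J_asym[OF that] by (simp add: F_def)
    then show ?thesis by (simp only: conseq_rev)
  qed
  have adj': "htg_adj (m + 2) n l u v" if "(x, y) \<in> C" "(u, v) \<in> conseq (x # F x y @ [y])" for x y u v
  proof -
    consider "?J x y" | "?J y x" | "\<not> ?J x y" "\<not> ?J y x" by blast
    then show ?thesis
    proof cases
      case 1 then show ?thesis using path[of x y] that by (simp add: F_def)
    next
      case 2
      then have "(v, u) \<in> conseq (y # D (snd y) @ [x])" using that(2) unfolding rev_F[OF 2] by auto
      then show ?thesis using path[OF _ 2] that(1) htg_adj_sym by blast
    next
      case 3 then show ?thesis using that htg_adj_insert_columns[OF adj] by (simp add: F_def)
    qed
  qed
  have dist_ws: "distinct ws"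
    unfolding ws_def
  proof (rule distinct_expand[OF dist], fold C_def)
    fix x y assume "(x, y) \<in> C"
    from F_cases[OF this] V show "distinct (F x y) \<and> set (F x y) \<inter> set vs = {}"
      unfolding htg_vertices_def by fastforce
  next
    fix x y x' y' assume xy: "(x, y) \<in> C" "(x', y') \<in> C" "x \<noteq> x'"
    show "set (F x y) \<inter> set (F x' y') = {}"
    proof (cases "F x y = [] \<or> F x' y' = []")
      case False
      obtain r where r: "set (F x y) = {m, m + 1} \<times> gap_rows n P r" "r \<in> P"
        "?J x y \<and> r = snd x \<or> ?J y x \<and> r = snd y"
        using F_cases[OF xy(1)] False by blast
      obtain r' where r': "set (F x' y') = {m, m + 1} \<times> gap_rows n P r'" "r' \<in> P"
        "?J x' y' \<and> r' = snd x' \<or> ?J y' x' \<and> r' = snd y'"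
        using F_cases[OF xy(2)] False by blast
      have "r \<noteq> r'"
      proof
        assume "r = r'"
        then have "y = x' \<and> x = y'" using r(3) r'(3) J_eq xy(3) by metis
        then show False using is_cycle_no_backtrack[OF cyc] xy unfolding C_def by blast
      qed
      from gap(5)[OF n0 r(2) r'(2) this] show ?thesis unfolding r(1) r'(1) by blast
    qed auto
  qed
  have set_ws: "set ws = set vs \<union> {m, m + 1} \<times> {0..<n}"
  proof -
    have "set ws = fst ` C \<union> (\<Union>(x, y) \<in> C. set (F x y))"
      unfolding ws_def set_expand C_def by force
    moreover have "fst ` C = set vs" unfolding C_def by (rule fst_conseq_snoc)
    moreover have "(\<Union>(x, y) \<in> C. set (F x y)) = {m, m + 1} \<times> (\<Union>r\<in>P. gap_rows n P r)"
    proof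
      show "(\<Union>(x, y) \<in> C. set (F x y)) \<subseteq> {m, m + 1} \<times> (\<Union>r\<in>P. gap_rows n P r)"
        using F_cases by fastforce
      have "{m, m + 1} \<times> gap_rows n P r \<subseteq> (\<Union>(x, y) \<in> C. set (F x y))" if r: "r \<in> P" for r
      proof -
        obtain u v where uv: "(u, v) \<in> C \<or> (v, u) \<in> C" "?J u v" "r = snd u" using r unfolding P_def by blast
        then have "set (F u v) = {m, m + 1} \<times> gap_rows n P r" "set (F v u) = {m, m + 1} \<times> gap_rows n P r"
          using J_asym by (auto simp: F_def set_D)
        with uv(1) show ?thesis by blast
      qed
      then show "{m, m + 1} \<times> (\<Union>r\<in>P. gap_rows n P r) \<subseteq> (\<Union>(x, y) \<in> C. set (F x y))" by blast
    qed
    ultimately show ?thesis using gap(6)[OF n0] by simp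
  qed
  \<comment> \<open>The length is read off from the vertex set instead of adding up the
    gaps.\<close>
  have "length ws = card (set vs \<union> {m, m + 1} \<times> {0..<n})"
    using distinct_card[OF dist_ws] set_ws by simp
  also have "\<dots> = length vs + 2 * nat n"
  proof -
    have "set vs \<inter> {m, m + 1} \<times> {0..<n} = {}" using V by (auto simp: htg_vertices_def)
    then show ?thesis by (simp add: card_Un_disjoint distinct_card[OF dist] card_cartesian_product)
  qed
  finally have len: "int (length ws) = int (length vs) + 2 * n" using n_pos by simp
  have cyc_ws: "is_cycle (htg_adj (m + 2) n l) ws"
    unfolding is_cycle_iff cws using dist_ws adj' len cyc n_pos by (auto simp: is_cycle_iff)
  define x where "x = (if ?J x0 y0 then x0 else y0)"
  define y where "y = (if ?J x0 y0 then y0 else x0)"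
  have xy: "?J x y" "(x, y) \<in> C \<or> (y, x) \<in> C" using xy0 by (auto simp: x_def y_def)
  have r: "snd x \<in> P" using PI[OF xy(2,1)] .
  have sub: "(u, v) \<in> conseq (ws @ [hd ws]) \<or> (v, u) \<in> conseq (ws @ [hd ws])"
    if "(u, v) \<in> conseq (x # D (snd x) @ [y])" for u v
  proof -
    have 1: "(u, v) \<in> conseq (x # F x y @ [y])" using that xy(1) by (simp add: F_def)
    have 2: "(v, u) \<in> conseq (y # F y x @ [x])"
      unfolding rev_F[OF xy(1)] using imageI[OF that, of prod.swap] by simp
    from xy(2) show ?thesis
    proof
      assume "(x, y) \<in> C" with 1 show ?thesis unfolding cws by blast
    next
      assume "(y, x) \<in> C" with 2 show ?thesis unfolding cws by blast
    qed
  qed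
  \<comment> \<open>A positive even gap is at least 2, so the detour has a vertical edge at its top
    in column \<open>m\<close>. The lower end of this edge has odd coordinate sum.\<close>
  have d: "gap n P (snd x) > 0" "Suc 0 < gap n P (snd x)"
    using gap(1)[OF n0 r] even_gap[OF r] by (auto intro: Suc_lessI)
  have rn: "snd x mod n = snd x" using r P by auto
  have "((m + 1, snd x), y) \<in> conseq (x # D (snd x) @ [y])"
    unfolding D_def conseq_detour[OF d(1)] rn by blast
  moreover have "htg_jump (m + 2) n l (m + 1, snd x) y" using xy(1) by (simp add: htg_jump_def)
  ultimately have J: "cycle_uses (htg_jump (m + 2) n l) ws" using sub unfolding cycle_uses_def by blast
  have "((m, (snd x - int 0) mod n), (m, (snd x - int (Suc 0)) mod n)) \<in> conseq (x # D (snd x) @ [y])"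
    unfolding D_def conseq_detour[OF d(1)] using d(2) by blast
  moreover have "black_up n (m, (snd x - int (Suc 0)) mod n) (m, (snd x - int 0) mod n)"
  proof -
    have "even (snd x) \<longleftrightarrow> even m" using P_par[OF r] by (simp only: even_iff_mod_2_eq_zero)
    then show ?thesis by (simp add: black_up_def mod_simps)
  qed
  ultimately have "cycle_uses (black_up n) ws" using sub unfolding cycle_uses_def by blast
  with that J cyc_ws len show thesis unfolding jump_cycle_def by blast
qed

section \<open>Explicit cycles through a jump edge\<close>

definition walk :: "('a \<Rightarrow> 'a \<Rightarrow> bool) \<Rightarrow> 'a list \<Rightarrow> bool" where
  "walk E xs \<longleftrightarrow> (\<forall>(u, v) \<in> conseq xs. E u v)"

lemma walkD: "walk E xs \<Longrightarrow> (u, v) \<in> conseq xs \<Longrightarrow> E u v"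
  by (auto simp: walk_def)

lemma walk_single [simp]: "walk E [x]"
  by (simp add: walk_def)

lemma walk_append [simp]:
  "xs \<noteq> [] \<Longrightarrow> ys \<noteq> [] \<Longrightarrow> walk E (xs @ ys) \<longleftrightarrow> walk E xs \<and> walk E ys \<and> E (last xs) (hd ys)"
  by (auto simp: walk_def conseq_append)

lemma walk_Cons [simp]: "ys \<noteq> [] \<Longrightarrow> walk E (x # ys) \<longleftrightarrow> walk E ys \<and> E x (hd ys)"
  using walk_append[of "[x]" ys E] by simp

lemma walk_rev: "(\<And>u v. E u v \<Longrightarrow> E v u) \<Longrightarrow> walk E xs \<Longrightarrow> walk E (rev xs)"
  by (auto simp: walk_def conseq_rev)

lemma walk_map_upto: "(\<And>j. a \<le> j \<Longrightarrow> j < b \<Longrightarrow> E (f j) (f (j + 1))) \<Longrightarrow> walk E (map f [a..b])"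
  by (auto simp: walk_def conseq_map conseq_upto)

lemma hd_upto [simp]: "a \<le> b \<Longrightarrow> hd [a..b] = a"
  by (simp add: upto_rec1)

lemma last_upto [simp]: "a \<le> b \<Longrightarrow> last [a..b] = b"
  by (simp add: upto_rec2)

definition vert :: "int \<Rightarrow> int \<Rightarrow> int \<Rightarrow> (int \<times> int) list" where
  "vert i a b = map (Pair i) [a..b]"

lemma vert_simps [simp]:
  "a \<le> b \<Longrightarrow> vert i a b \<noteq> []" "a \<le> b \<Longrightarrow> hd (vert i a b) = (i, a)" "a \<le> b \<Longrightarrow> last (vert i a b) = (i, b)"
  "length (vert i a b) = nat (b - a + 1)" "set (vert i a b) = {i} \<times> {a..b}" "distinct (vert i a b)"
  by (auto simp: vert_def hd_map last_map distinct_map inj_on_def)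

lemma brick_adj_sym: "brick_adj u v \<Longrightarrow> brick_adj v u"
  unfolding brick_adj_def by blast

lemma walk_vert [simp]: "walk brick_adj (vert i a b)" "walk brick_adj (rev (vert i a b))"
proof -
  show "walk brick_adj (vert i a b)"
    unfolding vert_def by (rule walk_map_upto) (simp add: brick_adj_def brick_step_def)
  then show "walk brick_adj (rev (vert i a b))" by (rule walk_rev[rotated]) (rule brick_adj_sym)
qed

lemma brick_adj_flat:
  "odd (i + j) \<Longrightarrow> brick_adj (i, j) (i + 1, j)" "odd (i + j) \<Longrightarrow> brick_adj (i + 1, j) (i, j)"
  by (simp_all add: brick_adj_def brick_step_def)

lemma conseq_append_junction:
  "xs \<noteq> [] \<Longrightarrow> ys \<noteq> [] \<Longrightarrow> (last xs, hd ys) \<in> conseq (xs @ ys)"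
  by (simp add: conseq_append)

text \<open>A nonzero lattice vector moves by at least \<open>m\<close> columns, or stays in its
  column and moves by at least \<open>n\<close> rows. The window of rows may therefore differ from
  column to column.\<close>

lemma (in honeycomb) inj_on_htg_red:
  assumes "\<And>i j. (i, j) \<in> S \<Longrightarrow> p \<le> i \<and> i < p + m"
    and "\<And>i j j'. (i, j) \<in> S \<Longrightarrow> (i, j') \<in> S \<Longrightarrow> j - j' < n"
  shows "inj_on (htg_red m n l) S"
proof (rule inj_onI)
  fix u v assume uv: "u \<in> S" "v \<in> S" "htg_red m n l u = htg_red m n l v"
  obtain i j i' j' where eq: "u = (i, j)" "v = (i', j')" by fastforce
  have "\<bar>i - i'\<bar> < m" using assms(1)[of i j] assms(1)[of i' j'] uv eq by auto
  moreover have "\<bar>j - j'\<bar> < n" if "i = i'" using assms(2)[of i j j'] assms(2)[of i j' j] uv eq that by auto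
  ultimately show "u = v" using htg_red_inj_window uv(3) unfolding eq by blast
qed

text \<open>The next three cycles are placed around the columns \<open>m - 1\<close>, \<open>m\<close>, \<open>m + 1\<close> of the brick wall
  so that they use a jump edge.\<close>

lemma (in honeycomb) jump_cycle_strip:
  assumes "m \<ge> 2" "f \<ge> 1" "2 * f < n"
  obtains vs where "jump_cycle m n l vs" "int (length vs) = 4 * f + 2"
proof
  \<comment> \<open>The boundary of \<open>f\<close> hexagons stacked between two neighbouring
    columns.\<close>
  let ?us = "vert (m - 1) m (m + 2 * f) @ rev (vert m m (m + 2 * f))"
  let ?w = "(m - 1, m)"
  show "jump_cycle m n l (map (htg_red m n l) ?us)"
  proof (rule jump_cycle_of_brick_walk[where w = ?w and j = "m + 2 * f"])
    have "inj_on (htg_red m n l) (set ?us)"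
      by (rule inj_on_htg_red[where p = "m - 1"]) (use assms in auto)
    moreover have "distinct ?us" by auto
    ultimately show "distinct (map (htg_red m n l) ?us)" by (simp only: distinct_map)
    have "walk brick_adj (?us @ [?w])"
      using assms brick_adj_flat[of "m - 1" "m + 2 * f"] brick_adj_flat[of "m - 1" m] by (simp add: last_rev hd_rev)
    then show "\<And>u v. (u, v) \<in> conseq (?us @ [?w]) \<Longrightarrow> brick_adj u v" by (rule walkD)
    show "((m - 1, m + 2 * f), m, m + 2 * f) \<in> conseq (?us @ [?w])"
      using conseq_append_junction[of "vert (m - 1) m (m + 2 * f)" "rev (vert m m (m + 2 * f)) @ [?w]"] assms
      by (simp add: hd_rev)
  qed (use assms in auto)
  show "int (length (map (htg_red m n l) ?us)) = 4 * f + 2" using assms by simp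
qed

text \<open>The longest strip has \<open>n div 2 - 1\<close> hexagons and boundary length
  \<open>2 * n - 2\<close>. One more hexagon, sharing a vertical edge with the strip in column
  \<open>m\<close>, adds 4.\<close>

lemma (in honeycomb) jump_cycle_strip_bump:
  assumes "m \<ge> 3" "n \<ge> 4"
  obtains vs where "jump_cycle m n l vs" "int (length vs) = 2 * n + 2"
proof
  let ?a = "vert (m - 1) m (m + n - 2)" and ?b = "rev (vert m (m + 1) (m + n - 2))"
    and ?c = "rev (vert (m + 1) (m - 1) (m + 1))" and ?d = "vert m (m - 1) m"
  let ?us = "?a @ ?b @ ?c @ ?d"
  let ?w = "(m - 1, m)"
  show "jump_cycle m n l (map (htg_red m n l) ?us)"
  proof (rule jump_cycle_of_brick_walk[where w = ?w and j = "m + n - 2"])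
    have "inj_on (htg_red m n l) (set ?us)"
      by (rule inj_on_htg_red[where p = "m - 1"]) (use assms in auto)
    moreover have "distinct ?us" by auto
    ultimately show "distinct (map (htg_red m n l) ?us)" by (simp only: distinct_map)
    have "walk brick_adj (?us @ [?w])"
      using assms n_even brick_adj_flat[of "m - 1" "m + n - 2"] brick_adj_flat[of m "m + 1"]
        brick_adj_flat[of m "m - 1"] brick_adj_flat[of "m - 1" m] by (simp add: last_rev hd_rev)
    then show "\<And>u v. (u, v) \<in> conseq (?us @ [?w]) \<Longrightarrow> brick_adj u v" by (rule walkD)
    show "((m - 1, m + n - 2), m, m + n - 2) \<in> conseq (?us @ [?w])"
      using conseq_append_junction[of ?a "(?b @ ?c @ ?d) @ [?w]"] assms
      by (simp add: hd_rev)
  qed (use assms n_even in auto)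
  show "int (length (map (htg_red m n l) ?us)) = 2 * n + 2" using assms by simp
qed

text \<open>The cycle winds once around the torus vertically; its columns contribute
  \<open>n - 1\<close>, \<open>n - 2 * t\<close> and \<open>n - 2 * t + 1\<close> vertices. It
  serves three columns with \<open>n div 2\<close> odd, where \<open>3 * n\<close> is 2 modulo
  4.\<close>

lemma (in honeycomb) jump_cycle_strip_column:
  assumes "m \<ge> 3" "t \<ge> 1" "2 * t + 4 \<le> n"
  obtains vs where "jump_cycle m n l vs" "int (length vs) = 3 * n - 4 * t"
proof
  let ?a = "vert (m - 1) m (m + n - 2)" and ?b = "rev (vert m (m + 1 + 2 * t) (m + n - 2))"
    and ?c = "vert (m + 1) (m + 1 + 2 * t) (m + n + 1)" and ?d = "rev (vert m (m + n) (m + n + 1))"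
  let ?us = "?a @ ?b @ ?c @ ?d"
  let ?w = "(m - 1, m + n)"
  show "jump_cycle m n l (map (htg_red m n l) ?us)"
  proof (rule jump_cycle_of_brick_walk[where w = ?w and j = "m + n - 2"])
    have "inj_on (htg_red m n l) (set ?us)"
      by (rule inj_on_htg_red[where p = "m - 1"]) (use assms in auto)
    moreover have "distinct ?us" using assms by auto
    ultimately show "distinct (map (htg_red m n l) ?us)" by (simp only: distinct_map)
    have "walk brick_adj (?us @ [?w])"
      using assms n_even brick_adj_flat[of "m - 1" "m + n - 2"] brick_adj_flat[of m "m + 1 + 2 * t"]
        brick_adj_flat[of m "m + n + 1"] brick_adj_flat[of "m - 1" "m + n"] by (simp add: last_rev hd_rev)
    then show "\<And>u v. (u, v) \<in> conseq (?us @ [?w]) \<Longrightarrow> brick_adj u v" by (rule walkD)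
    show "htg_red m n l ?w = htg_red m n l (hd ?us)"
      using assms by (simp add: htg_red_eq_iff)
    show "((m - 1, m + n - 2), m, m + n - 2) \<in> conseq (?us @ [?w])"
      using conseq_append_junction[of ?a "(?b @ ?c @ ?d) @ [?w]"] assms
      by (simp add: hd_rev)
  qed (use assms n_even in auto)
  show "int (length (map (htg_red m n l) ?us)) = 3 * n - 4 * t" using assms by simp
qed

section \<open>Symmetries of the brick wall: exchange of directions and reflection\<close>

text \<open>This automorphism of the brick wall exchanges flat edges with one of the two classes of vertical
  edges. In the coordinates in which \<open>(i, j)\<close> is \<open>(a, b) = (i, (j - i) div 2)\<close>, it exchanges \<open>a\<close> and \<open>b\<close>.\<close>

definition brick_swap :: "int \<times> int \<Rightarrow> int \<times> int" where
  "brick_swap u = (let b = (snd u - fst u) div 2 in (b, 2 * fst u + b + (snd u - fst u) mod 2))"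

lemma brick_swap_eq: "brick_swap (i, i + 2 * b) = (b, 2 * i + b)"
  "brick_swap (i, i + 2 * b + 1) = (b, 2 * i + b + 1)"
  by (simp_all add: brick_swap_def)

lemma brick_cases:
  obtains b where "j = i + 2 * b" | b where "j = i + 2 * b + (1::int)"
proof -
  have "j = i + 2 * ((j - i) div 2) + (j - i) mod 2" by simp
  moreover have "(j - i) mod 2 = 0 \<or> (j - i) mod 2 = 1" by auto
  ultimately show thesis using that by (metis add_0_right)
qed

lemma brick_swap_black_up:
  assumes "odd (i + j)"
  obtains i' j' where "brick_swap (i, j) = (i', j')" "brick_swap (i, j + 1) = (i' + 1, j')" "odd (i' + j')"
proof (cases rule: brick_cases[of j i])
  case (1 b) then show ?thesis using assms by simp
next
  case (2 b)
  have "i + 2 * b + 1 + 1 = i + 2 * (b + 1)" by simp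
  then have "brick_swap (i, j + 1) = (b + 1, 2 * i + b + 1)"
    unfolding 2 using brick_swap_eq(1)[of i "b + 1"] by (simp add: algebra_simps)
  with 2 brick_swap_eq(2)[of i b] show ?thesis by (intro that) auto
qed

lemma brick_swap_adj:
  assumes "brick_step u v"
  shows "brick_adj (brick_swap u) (brick_swap v)"
proof -
  obtain i j where u: "u = (i, j)" by fastforce
  consider "v = (i, j + 1)" "odd (i + j)" | "v = (i, j + 1)" "even (i + j)" | "v = (i + 1, j)" "odd (i + j)"
    using assms unfolding u brick_step_def by (cases v) auto
  then show ?thesis
  proof cases
    case 1
    obtain i' j' where "brick_swap (i, j) = (i', j')" "brick_swap (i, j + 1) = (i' + 1, j')" "odd (i' + j')"
      by (rule brick_swap_black_up[OF 1(2)])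
    then show ?thesis unfolding u 1(1) by (simp add: brick_adj_def brick_step_def)
  next
    case 2
    obtain b where "j = i + 2 * b" using 2(2) by (cases rule: brick_cases[of j i]) auto
    then show ?thesis unfolding u 2(1) by (simp add: brick_swap_eq brick_adj_def brick_step_def)
  next
    case 3
    obtain b where j: "j = i + 2 * b + 1" using 3(2) by (cases rule: brick_cases[of j i]) auto
    then have "j = (i + 1) + 2 * b" by simp
    then have "brick_swap (i + 1, j) = (b, 2 * (i + 1) + b)" using brick_swap_eq(1)[of "i + 1" b] by simp
    moreover have "brick_swap (i, j) = (b, 2 * i + b + 1)" unfolding j by (rule brick_swap_eq)
    ultimately show ?thesis unfolding u 3(1) by (simp add: brick_adj_def brick_step_def)
  qed
qed

text \<open>In the coordinates \<open>(a, b)\<close> the lattice of \<open>HTG(m, 2 h, 2 c - m)\<close> is spanned by \<open>(0, h)\<close> and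
  \<open>(m, - c)\<close>. Exchanging the coordinates gives the lattice spanned by \<open>(0, m h / g)\<close> and
  \<open>(g, m s)\<close> with \<open>g = gcd c h\<close> and \<open>c s \<equiv> - g\<close> modulo \<open>h\<close>.\<close>

lemma swapped_lattice:
  fixes m h c :: int
  assumes "m > 0" "h > 0"
  obtains c' where "\<And>\<alpha> \<beta>. (\<exists>s. \<alpha> = gcd c h * s \<and> (m * (h div gcd c h)) dvd \<beta> + c' * s) \<longleftrightarrow>
    (\<exists>s. \<beta> = m * s \<and> h dvd \<alpha> + c * s)"
proof -
  define g where "g = gcd c h"
  have g: "g > 0" using assms by (simp add: g_def)
  obtain c1 h1 where c1: "c = g * c1" and h1: "h = g * h1"
    unfolding g_def by (meson dvdE gcd_dvd1 gcd_dvd2)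
  obtain x y where "x * c + y * h = g" unfolding g_def using bezout_int by blast
  then have "g * (x * c1 + y * h1) = g * 1" unfolding c1 h1 by (simp add: algebra_simps)
  then have bez: "x * c1 + y * h1 = 1" using g by simp
  have div: "h div g = h1" using g h1 by simp
  show thesis
  \<comment> \<open>As \<open>x * c\<close> is congruent to \<open>g\<close> modulo
    \<open>h\<close>, the vector \<open>(g, - m * x)\<close> lies in the exchanged lattice.\<close>
  proof (rule that[of "m * x"], fold g_def, unfold div)
    fix \<alpha> \<beta>
    show "(\<exists>s. \<alpha> = g * s \<and> m * h1 dvd \<beta> + m * x * s) \<longleftrightarrow> (\<exists>s. \<beta> = m * s \<and> h dvd \<alpha> + c * s)"
    proof
      assume "\<exists>s. \<alpha> = g * s \<and> m * h1 dvd \<beta> + m * x * s"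
      then obtain s z where s: "\<alpha> = g * s" "\<beta> + m * x * s = m * h1 * z" by (auto elim!: dvdE)
      have "\<beta> = m * (h1 * z - x * s)" using s(2) by (simp add: algebra_simps)
      moreover have "\<alpha> + c * (h1 * z - x * s) = h * (c1 * z + y * s)"
      proof -
        have "\<alpha> + c * (h1 * z - x * s) = g * (s * (1 - x * c1) + c1 * h1 * z)"
          unfolding s(1) c1 by (simp add: algebra_simps)
        also have "1 - x * c1 = y * h1" using bez by simp
        finally show ?thesis unfolding h1 by (simp add: algebra_simps)
      qed
      ultimately show "\<exists>s. \<beta> = m * s \<and> h dvd \<alpha> + c * s" by (metis dvd_triv_left)
    next
      assume "\<exists>s. \<beta> = m * s \<and> h dvd \<alpha> + c * s"
      then obtain s z where s: "\<beta> = m * s" "\<alpha> + c * s = h * z" by (auto elim!: dvdE)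
      have a: "\<alpha> = g * (h1 * z - c1 * s)" using s(2) unfolding c1 h1 by (simp add: algebra_simps)
      have "\<beta> + m * x * (h1 * z - c1 * s) = m * (s * (1 - x * c1) + x * h1 * z)"
        unfolding s(1) by (simp add: algebra_simps)
      also have "1 - x * c1 = y * h1" using bez by simp
      finally have "\<beta> + m * x * (h1 * z - c1 * s) = m * h1 * (s * y + x * z)" by (simp add: algebra_simps)
      with a show "\<exists>s. \<alpha> = g * s \<and> m * h1 dvd \<beta> + m * x * s" by (metis dvd_triv_left)
    qed
  qed
qed

text \<open>Both generators \<open>(0, n)\<close> and \<open>(m, - l)\<close> have even coordinate
  sum, so the quotient inherits the 2-colouring of the brick wall.\<close>

lemma (in honeycomb) lattice_parity:
  assumes "i - i' = m * s" "n dvd j - j' + l * s"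
  shows "even (i + j) \<longleftrightarrow> even (i' + j')"
proof -
  have "even (j - j' + l * s)" using assms(2) n_even by (rule dvd_trans[rotated])
  moreover have "even l \<longleftrightarrow> even m" using l_parity by (simp only: even_iff_mod_2_eq_zero)
  moreover have "even (i - i') \<longleftrightarrow> even (m * s)" using assms(1) by simp
  ultimately show ?thesis by auto
qed

text \<open>Vertices of different colours are identified on neither side. Within one colour the
  position inside a cell cancels, and the claim becomes the exchange of lattices in the coordinates
  \<open>(a, b)\<close>.\<close>

lemma honeycomb_swap:
  fixes m h c :: int
  assumes "honeycomb m (2 * h) (2 * c - m)"
  obtains l' where "honeycomb (gcd c h) (2 * (m * (h div gcd c h))) l'"
    "\<And>u v. htg_red (gcd c h) (2 * (m * (h div gcd c h))) l' u = htg_red (gcd c h) (2 * (m * (h div gcd c h))) l' v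
      \<longleftrightarrow> htg_red m (2 * h) (2 * c - m) (brick_swap u) = htg_red m (2 * h) (2 * c - m) (brick_swap v)"
proof -
  interpret H: honeycomb m "2 * h" "2 * c - m" by fact
  define g where "g = gcd c h"
  define h' where "h' = m * (h div g)"
  have pos: "m > 0" "h > 0" using H.m_pos H.n_pos by auto
  then have g: "g > 0" by (simp add: g_def)
  have "g dvd h" by (simp add: g_def)
  then have "h div g > 0" using g pos by (simp add: pos_imp_zdiv_pos_iff zdvd_imp_le)
  then have h': "h' > 0" using pos by (simp add: h'_def)
  obtain c' where c': "\<And>\<alpha> \<beta>. (\<exists>s. \<alpha> = g * s \<and> h' dvd \<beta> + c' * s) \<longleftrightarrow> (\<exists>s. \<beta> = m * s \<and> h dvd \<alpha> + c * s)"
  proof (rule swapped_lattice[OF pos, of c, folded g_def, folded h'_def])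
    fix c'
    assume "\<And>\<alpha> \<beta>. (\<exists>s. \<alpha> = g * s \<and> h' dvd \<beta> + c' * s) \<longleftrightarrow> (\<exists>s. \<beta> = m * s \<and> h dvd \<alpha> + c * s)"
    then show thesis by (rule that)
  qed
  have hc: "honeycomb g (2 * h') (2 * c' - g)"
    using g h' by unfold_locales (auto simp: mod2_eq_if)
  interpret H': honeycomb g "2 * h'" "2 * c' - g" by fact
  show thesis
  proof (rule that[of "2 * c' - g"], fold g_def, fold h'_def)
    fix u v :: "int \<times> int"
    obtain i j i' j' where uv: "u = (i, j)" "v = (i', j')" by fastforce
    let ?L = "\<exists>s. i - i' = g * s \<and> 2 * h' dvd j - j' + (2 * c' - g) * s"
    obtain p q p' q' where sw: "brick_swap u = (p, q)" "brick_swap v = (p', q')" by fastforce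
    let ?R = "\<exists>s. p - p' = m * s \<and> 2 * h dvd q - q' + (2 * c - m) * s"
    have par: "even (p + q) = even (i + j)" "even (p' + q') = even (i' + j')"
    proof -
      have *: "even (fst (brick_swap (i, j)) + snd (brick_swap (i, j))) = even (i + j)" for i j
        by (cases rule: brick_cases[of j i]) (auto simp: brick_swap_eq)
      show "even (p + q) = even (i + j)" "even (p' + q') = even (i' + j')"
        using *[of i j] *[of i' j'] sw uv by simp_all
    qed
    have "?L \<longleftrightarrow> ?R"
    proof (cases "even (i + j) = even (i' + j')")
      case False
      then show ?thesis using H'.lattice_parity[of i i' _ j j'] H.lattice_parity[of p p' _ q q'] par by blast
    next
      case True
      obtain b b' where b: "j - j' = 2 * (b - b') + (i - i')" "p = b" "p' = b'" "q - q' = 2 * (i - i') + (b - b')"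
      proof (cases "even (i + j)")
        case e: True
        obtain b where b: "j = i + 2 * b" using e by (cases rule: brick_cases[of j i]) auto
        obtain b' where b': "j' = i' + 2 * b'" using e True by (cases rule: brick_cases[of j' i']) auto
        show ?thesis using that[of b b'] sw unfolding uv b b' brick_swap_eq by simp
      next
        case o: False
        obtain b where b: "j = i + 2 * b + 1" using o by (cases rule: brick_cases[of j i]) auto
        obtain b' where b': "j' = i' + 2 * b' + 1" using o True by (cases rule: brick_cases[of j' i']) auto
        show ?thesis using that[of b b'] sw unfolding uv b b' brick_swap_eq by simp
      qed
      have L: "2 * h' dvd j - j' + (2 * c' - g) * s \<longleftrightarrow> h' dvd (b - b') + c' * s" if "i - i' = g * s" for s
      proof -
        have "j - j' + (2 * c' - g) * s = 2 * ((b - b') + c' * s)" using b(1) that by (simp add: algebra_simps)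
        then show ?thesis by (simp only: dvd_mult_cancel_left) simp
      qed
      have R: "2 * h dvd q - q' + (2 * c - m) * s \<longleftrightarrow> h dvd (i - i') + c * s" if "p - p' = m * s" for s
      proof -
        have "q - q' + (2 * c - m) * s = 2 * ((i - i') + c * s)" using b(2-4) that by (simp add: algebra_simps)
        then show ?thesis by (simp only: dvd_mult_cancel_left) simp
      qed
      have "?L \<longleftrightarrow> (\<exists>s. i - i' = g * s \<and> h' dvd (b - b') + c' * s)" using L by blast
      also have "\<dots> \<longleftrightarrow> (\<exists>s. p - p' = m * s \<and> h dvd (i - i') + c * s)" unfolding b(2,3) by (rule c')
      also have "\<dots> \<longleftrightarrow> ?R" using R by blast
      finally show ?thesis .
    qed
    then show "htg_red g (2 * h') (2 * c' - g) u = htg_red g (2 * h') (2 * c' - g) v \<longleftrightarrow>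
      htg_red m (2 * h) (2 * c - m) (brick_swap u) = htg_red m (2 * h) (2 * c - m) (brick_swap v)"
      unfolding sw unfolding uv H.htg_red_eq_iff H'.htg_red_eq_iff .
  qed (rule hc)
qed

lemma reflect_step: "brick_step u v \<Longrightarrow> brick_adj (fst u, - snd u) (fst v, - snd v)"
  by (auto simp: brick_step_def brick_adj_def)

text \<open>Negating rows sends the generator \<open>(m, - l')\<close> to \<open>(m, l')\<close>,
  which together with \<open>(0, n)\<close> spans the lattice of every \<open>l\<close> congruent to
  \<open>- l'\<close>.\<close>

lemma reflected_cycle:
  assumes "honeycomb m n l" "honeycomb m n l'" "n dvd l + l'" "is_cycle (htg_adj m n l') vs"
  shows "is_cycle (htg_adj m n l) (map (htg_red m n l \<circ> (\<lambda>u. (fst u, - snd u))) vs)"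
proof (rule cycle_transport[OF assms(1,2) reflect_step _ assms(4)])
  interpret H: honeycomb m n l by fact
  interpret H': honeycomb m n l' by fact
  fix u v :: "int \<times> int"
  have "n dvd snd u - snd v + l' * s \<longleftrightarrow> n dvd - snd u - - snd v + l * s" for s
  proof -
    have "snd u - snd v + l' * s = (l + l') * s - (- snd u - - snd v + l * s)" by (simp add: algebra_simps)
    moreover have "n dvd (l + l') * s" using assms(3) by simp
    ultimately show ?thesis by (metis dvd_diff_right_iff)
  qed
  then show "htg_red m n l' u = htg_red m n l' v \<longleftrightarrow>
      htg_red m n l (fst u, - snd u) = htg_red m n l (fst v, - snd v)"
    unfolding H.htg_red_eq_iff H'.htg_red_eq_iff[of "fst u" "snd u" "fst v" "snd v", simplified prod.collapse] by simp
qed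

section \<open>Hamiltonian cycles through a jump edge for one column\<close>

lemma (in honeycomb) one_column_params:
  assumes "m = 1" obtains h c where "n = 2 * h" "l = 2 * c - 1"
proof -
  have "odd l" using l_parity assms by (simp add: odd_iff_mod_2_eq_one)
  then have "l = 2 * ((l + 1) div 2) - 1" "n = 2 * (n div 2)" using n_even by (auto elim: oddE)
  then show thesis using that by blast
qed

text \<open>In the coordinates \<open>(a, b)\<close> the staircase advances by
  \<open>(1, 0)\<close>, which equals \<open>(0, c)\<close> in the quotient. Since \<open>c\<close>
  is a unit modulo \<open>h\<close>, it meets all \<open>h\<close> cells, with two vertices each,
  before it closes.\<close>

lemma stair_cycle:
  assumes "honeycomb 1 (2 * h) (2 * c - 1)" "gcd c h = 1" "h \<ge> 3"
  obtains vs where "jump_cycle 1 (2 * h) (2 * c - 1) vs" "int (length vs) = 2 * h"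
proof
  interpret honeycomb 1 "2 * h" "2 * c - 1" by fact
  let ?f = "\<lambda>x::int. (x div 2, (x + 1) div 2)"
  let ?us = "map ?f [0..2 * h - 1]"
  have us: "?us @ [(h, h)] = map ?f [0..2 * h]"
    using assms(3) by (simp add: upto_rec2[of 0 "2 * h"])
  have ev: "?f (2 * t) = (t, t)" "?f (2 * t + 1) = (t, t + 1)" for t :: int by simp_all
  have adj: "brick_adj (?f x) (?f (x + 1))" for x
  proof (cases "even x")
    case True
    then obtain t where x: "x = 2 * t" by (elim evenE)
    show ?thesis unfolding x ev by (simp add: brick_adj_def brick_step_def)
  next
    case False
    then obtain t where x: "x = 2 * t + 1" by (elim oddE)
    have "?f x = (t, t + 1)" "?f (x + 1) = (t + 1, t + 1)" unfolding x by simp_all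
    then show ?thesis by (simp add: brick_adj_def brick_step_def)
  qed
  show "jump_cycle 1 (2 * h) (2 * c - 1) (map (htg_red 1 (2 * h) (2 * c - 1)) ?us)"
  proof (rule jump_cycle_of_brick_walk[where w = "(h, h)" and j = 1])
    have "inj_on (htg_red 1 (2 * h) (2 * c - 1) \<circ> ?f) {0..2 * h - 1}"
    proof (rule inj_onI)
      fix x y assume xy: "x \<in> {0..2 * h - 1}" "y \<in> {0..2 * h - 1}"
        "(htg_red 1 (2 * h) (2 * c - 1) \<circ> ?f) x = (htg_red 1 (2 * h) (2 * c - 1) \<circ> ?f) y"
      then have dvd: "2 * h dvd ((x + 1) div 2 - (y + 1) div 2) + (2 * c - 1) * (x div 2 - y div 2)"
        by (simp add: htg_red_eq_iff)
      have "even x = even y"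
        using lattice_parity[of "x div 2" "y div 2" "x div 2 - y div 2", OF _ dvd] by presburger
      then have e: "(x + 1) div 2 - (y + 1) div 2 = x div 2 - y div 2" by presburger
      have "2 * h dvd 2 * (c * (x div 2 - y div 2))" using dvd unfolding e by (simp add: algebra_simps)
      then have "h dvd c * (x div 2 - y div 2)" by simp
      then have "h dvd x div 2 - y div 2"
        using assms(2) by (metis coprime_commute coprime_dvd_mult_right_iff coprime_iff_gcd_eq_1)
      moreover have "0 \<le> x div 2" "x div 2 < h" "0 \<le> y div 2" "y div 2 < h" using xy(1,2) by auto
      then have "\<bar>x div 2 - y div 2\<bar> < h" by linarith
      ultimately have "x div 2 = y div 2" using dvd_imp_le_int[of "x div 2 - y div 2" h] assms(3) by fastforce
      then show "x = y" using \<open>even x = even y\<close> by presburger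
    qed
    then show "distinct (map (htg_red 1 (2 * h) (2 * c - 1)) ?us)"
      by (simp add: distinct_map)
    show "length ?us \<ge> 3" using assms(3) by simp
    show "\<And>u v. (u, v) \<in> conseq (?us @ [(h, h)]) \<Longrightarrow> brick_adj u v"
      unfolding us using walk_map_upto[of 0 "2 * h" brick_adj ?f, OF adj] by (rule walkD)
    have "h - 0 + (2 * c - 1) * h = 2 * h * c" by (simp add: algebra_simps)
    then have "2 * h dvd h - 0 + (2 * c - 1) * h" by (simp only: dvd_triv_left)
    then have "htg_red 1 (2 * h) (2 * c - 1) (h, h) = htg_red 1 (2 * h) (2 * c - 1) (0, 0)"
      unfolding htg_red_eq_iff by auto
    moreover have "hd ?us = (0, 0)" using assms(3) by (simp add: hd_map)
    ultimately show "htg_red 1 (2 * h) (2 * c - 1) (h, h) = htg_red 1 (2 * h) (2 * c - 1) (hd ?us)"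
      by (simp only:)
    show "((1 - 1, 1), (1, 1)) \<in> conseq (?us @ [(h, h)])"
      unfolding us conseq_map conseq_upto using assms(3) by (auto intro!: image_eqI[of _ _ "(1, 2)"])
  qed simp
  show "int (length (map (htg_red 1 (2 * h) (2 * c - 1)) ?us)) = 2 * h" using assms(3) by simp
qed

text \<open>If \<open>n\<close> divides \<open>l + 1\<close>, the jump edge at an odd row
  \<open>j\<close> leads to row \<open>j - 1\<close> and is parallel to a vertical edge, so the
  column itself uses a jump edge.\<close>

lemma column_cycle:
  assumes "honeycomb 1 n l" "n \<ge> 3"
  shows "is_cycle (htg_adj 1 n l) (vert 0 0 (n - 1))"
    "n dvd l + 1 \<Longrightarrow> jump_cycle 1 n l (vert 0 0 (n - 1))"
proof -
  interpret honeycomb 1 n l by fact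
  have red: "htg_red 1 n l (0, j) = (0, j mod n)" for j by (simp add: htg_red_def)
  have eq: "map (htg_red 1 n l) (vert 0 0 (n - 1)) = vert 0 0 (n - 1)"
    unfolding vert_def by (auto simp: red)
  have "vert 0 0 (n - 1) @ [(0, n)] = vert 0 0 n"
    unfolding vert_def using assms(2) by (simp add: upto_rec2[of 0 n])
  then have W: "walk brick_adj (vert 0 0 (n - 1) @ [(0, n)])" by (simp only: walk_vert)
  have "is_cycle (htg_adj 1 n l) (map (htg_red 1 n l) (vert 0 0 (n - 1)))"
  proof (rule cycle_of_brick_walk[OF _ _ walkD[OF W]])
    have "hd (vert 0 0 (n - 1)) = (0, 0)" using assms(2) by simp
    then show "htg_red 1 n l (0, n) = htg_red 1 n l (hd (vert 0 0 (n - 1)))"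
      by (simp only: red) simp
  qed (use assms(2) in \<open>simp_all add: eq\<close>)
  then show cyc: "is_cycle (htg_adj 1 n l) (vert 0 0 (n - 1))" unfolding eq .
  show "jump_cycle 1 n l (vert 0 0 (n - 1))" if "n dvd l + 1"
  proof -
    have "((0, 0), (0, 1)) \<in> conseq (vert 0 0 (n - 1))"
      unfolding vert_def conseq_map conseq_upto using assms(2) by (auto intro!: image_eqI[of _ _ "(0, 1)"])
    then have "((0, 0), (0, 1)) \<in> conseq (vert 0 0 (n - 1) @ [hd (vert 0 0 (n - 1))])"
      using assms(2) conseq_append[of "vert 0 0 (n - 1)"] by simp
    moreover have "htg_jump 1 n l (0, 1) (0, 0)" using that by (simp add: htg_jump_def add.commute)
    ultimately show ?thesis using cyc unfolding jump_cycle_def cycle_uses_def by blast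
  qed
qed

text \<open>With a single column every flat edge of the brick wall projects to a jump edge.\<close>

lemma black_up_transport:
  assumes "honeycomb 1 n l" "honeycomb m' n' l'"
    and eq: "\<And>u v. htg_red m' n' l' u = htg_red m' n' l' v \<longleftrightarrow>
      htg_red 1 n l (brick_swap u) = htg_red 1 n l (brick_swap v)"
    and cyc: "is_cycle (htg_adj m' n' l') vs" "cycle_uses (black_up n') vs"
  shows "jump_cycle 1 n l (map (htg_red 1 n l \<circ> brick_swap) vs)"
proof -
  interpret H: honeycomb 1 n l by fact
  interpret H': honeycomb m' n' l' by fact
  let ?f = "htg_red 1 n l \<circ> brick_swap"
  have cyc': "is_cycle (htg_adj 1 n l) (map ?f vs)"
    by (rule cycle_transport[OF assms(1,2) brick_swap_adj eq cyc(1)])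
  have jump: "htg_jump 1 n l (?f u) (?f v)"
    if uv: "black_up n' u v" "u \<in> htg_vertices m' n'" "v \<in> htg_vertices m' n'" for u v
  proof -
    obtain i j where u: "u = (i, j)" by fastforce
    have v: "v = (i, (j + 1) mod n')" and odd: "odd (i + j)" using uv(1) u by (auto simp: black_up_def prod_eq_iff)
    have "htg_red m' n' l' (i, j + 1) = v"
      using uv(2) u v by (auto simp: htg_red_def htg_vertices_def)
    then have "htg_red m' n' l' (i, j + 1) = htg_red m' n' l' v" using H'.htg_red_ident[OF uv(3)] by simp
    then have fv: "?f v = htg_red 1 n l (brick_swap (i, j + 1))" unfolding eq by simp
    obtain i' j' where sw: "brick_swap (i, j) = (i', j')" "brick_swap (i, j + 1) = (i' + 1, j')" "odd (i' + j')"
      by (rule brick_swap_black_up[OF odd])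
    have "i' mod 1 = 1 - 1" by simp
    from H.htg_jump_htg_red[OF sw(3) this] show ?thesis unfolding fv sw(2) by (simp add: u sw(1))
  qed
  obtain u v where uv: "(u, v) \<in> conseq (vs @ [hd vs])" "black_up n' u v \<or> black_up n' v u"
    using cyc(2) unfolding cycle_uses_def by blast
  then have "htg_adj m' n' l' u v" using cyc(1) unfolding is_cycle_iff by blast
  then have V: "u \<in> htg_vertices m' n'" "v \<in> htg_vertices m' n'" unfolding htg_adj_def by blast+
  have "vs \<noteq> []" using cyc(1) by (auto simp: is_cycle_iff)
  then have hd: "map ?f vs @ [hd (map ?f vs)] = map ?f (vs @ [hd vs])" by (simp add: hd_map)
  have "(?f u, ?f v) \<in> conseq (map ?f vs @ [hd (map ?f vs)])"
    unfolding hd conseq_map using imageI[OF uv(1), of "map_prod ?f ?f"] by simp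
  moreover have "htg_jump 1 n l (?f u) (?f v) \<or> htg_jump 1 n l (?f v) (?f u)"
    using jump uv(2) V by blast
  ultimately show ?thesis using cyc' unfolding jump_cycle_def cycle_uses_def by blast
qed

lemma insert_columns_iter:
  assumes "honeycomb 1 n l" "jump_cycle 1 n l vs" "int (length vs) = n"
  shows "\<exists>ws. jump_cycle (2 * int k + 1) n l ws \<and> int (length ws) = (2 * int k + 1) * n \<and>
    (k > 0 \<longrightarrow> cycle_uses (black_up n) ws)"
proof (induction k)
  case 0 then show ?case using assms by (intro exI[of _ vs]) simp
next
  case (Suc k)
  then obtain ws where ws: "jump_cycle (2 * int k + 1) n l ws" "int (length ws) = (2 * int k + 1) * n" by blast
  interpret H: honeycomb 1 n l by fact
  interpret honeycomb "2 * int k + 1" n l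
    using H.n_pos H.n_even H.l_parity by unfold_locales auto
  obtain ws' where "jump_cycle (2 * int k + 1 + 2) n l ws'" "cycle_uses (black_up n) ws'"
    "int (length ws') = int (length ws) + 2 * n"
    by (rule insert_columns[OF ws(1)])
  with ws(2) show ?case by (intro exI[of _ ws']) (simp add: algebra_simps)
qed

text \<open>If neither a column nor a staircase is a Hamiltonian cycle through a jump edge, then the
  graph has \<open>g\<close> columns in one of the other two directions with \<open>1 < g < h\<close>, and its Hamiltonian
  cycle comes from the graph with just one of these columns.\<close>

lemma hamiltonian_jump_cycle:
  assumes "honeycomb 1 (2 * h) l" "odd h" "h \<ge> 3"
  shows "\<exists>vs. jump_cycle 1 (2 * h) l vs \<and> int (length vs) = 2 * h"
  using assms
proof (induction "nat h" arbitrary: h l rule: less_induct)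
  case less
  interpret honeycomb 1 "2 * h" l by fact
  obtain c where l: "l = 2 * c - 1" using one_column_params by metis
  define g where "g = gcd c h"
  have g: "g > 0" "g dvd h" "g dvd c" using less.prems(3) by (auto simp: g_def)
  consider "g = 1" | "g = h" | "1 < g" "g < h"
    using g zdvd_imp_le[of g h] less.prems(3) by linarith
  then show ?case
  proof cases
    case 1
    obtain vs where "jump_cycle 1 (2 * h) l vs" "int (length vs) = 2 * h"
      using stair_cycle[of h c] less.prems 1 unfolding l g_def by metis
    then show ?thesis by blast
  next
    case 2
    then have "2 * h dvd l + 1" using g(3) unfolding l by simp
    then have "jump_cycle 1 (2 * h) l (vert 0 0 (2 * h - 1))"
      using column_cycle(2)[OF less.prems(1)] less.prems(3) by simp
    then show ?thesis using less.prems(3) by (intro exI[of _ "vert 0 0 (2 * h - 1)"]) simp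
  next
    case 3
    obtain h' where h': "h = g * h'" using g(2) by (elim dvdE)
    have div: "h div g = h'" using h' g(1) by simp
    have odd: "odd g" "odd h'" using less.prems(2) h' by simp_all
    have "h' > 0" using h' g(1) less.prems(3) by (metis zero_less_mult_pos order_less_le_trans zero_less_numeral)
    moreover have "h' \<noteq> 1" using h' 3 by auto
    ultimately have h3: "h' \<ge> 3" using odd(2) by (cases "h' = 2") auto
    have "h' < h" using 3(1) \<open>h' > 0\<close> unfolding h' by simp
    obtain l' where l': "honeycomb g (2 * h') l'"
      "\<And>u v. htg_red g (2 * h') l' u = htg_red g (2 * h') l' v
        \<longleftrightarrow> htg_red 1 (2 * h) l (brick_swap u) = htg_red 1 (2 * h) l (brick_swap v)"
      using honeycomb_swap[of 1 h c, folded g_def, unfolded div mult_1 l[symmetric]] less.prems(1) by metis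
    interpret S: honeycomb g "2 * h'" l' by fact
    \<comment> \<open>As \<open>g\<close> is odd, \<open>l'\<close> has the right parity for one
      column too, and inserting pairs of columns leads back to \<open>g\<close>. At least one pair
      is inserted, which supplies the \<open>black_up\<close> edge.\<close>
    have one: "honeycomb 1 (2 * h') l'"
      using h3 S.l_parity odd(1) by unfold_locales (auto simp: odd_iff_mod_2_eq_one)
    obtain vs where vs: "jump_cycle 1 (2 * h') l' vs" "int (length vs) = 2 * h'"
      using less.hyps[of h' l'] \<open>h' < h\<close> h3 odd(2) one by auto
    obtain q where "g = 2 * q + 1" using odd(1) by (elim oddE)
    with g(1) have "g = 2 * int (nat q) + 1" by simp
    then obtain k where k: "g = 2 * int k + 1" by blast
    have "k > 0" using k 3(1) by (cases k) auto
    then obtain ws where ws: "jump_cycle g (2 * h') l' ws" "int (length ws) = g * (2 * h')" "cycle_uses (black_up (2 * h')) ws"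
      using insert_columns_iter[OF one vs, of k] unfolding k by blast
    have "jump_cycle 1 (2 * h) l (map (htg_red 1 (2 * h) l \<circ> brick_swap) ws)"
      using black_up_transport[OF less.prems(1) l'] ws(1,3) unfolding jump_cycle_def by blast
    then show ?thesis using ws(2) by (intro exI[of _ "map (htg_red 1 (2 * h) l \<circ> brick_swap) ws"]) (simp add: h')
  qed
qed

section \<open>Descent on the number of columns\<close>

lemma jump_cycle_exists:
  assumes "honeycomb m n l" "m \<ge> 2" "n \<ge> 4" "odd m \<Longrightarrow> odd (n div 2)" "f \<ge> 1" "4 * f + 2 \<le> m * n"
  shows "\<exists>vs. jump_cycle m n l vs \<and> int (length vs) = 4 * f + 2"
  using assms
proof (induction "nat m" arbitrary: m f rule: less_induct)
  case less
  interpret honeycomb m n l by fact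
  obtain h where n: "n = 2 * h" using n_even by blast
  have h: "h \<ge> 2" using less.prems(3) n by simp
  consider "2 * f < n" | "2 * f \<ge> n" "m = 2" | "2 * f \<ge> n" "m = 3" | "2 * f = n" "m \<ge> 4" | "2 * f > n" "m \<ge> 4"
    using less.prems(2) by linarith
  then show ?case
  proof cases
    case 1
    then show ?thesis using jump_cycle_strip[of f] less.prems by metis
  next
    case 2
    \<comment> \<open>\<open>4 * f + 2 \<le> 4 * h\<close> forces \<open>f < h\<close>.\<close>
    then have False using less.prems(6) unfolding n by simp
    then show ?thesis ..
  next
    case 3
    have odd: "odd h" using less.prems(4) 3 n by simp
    then obtain k where k: "h = 2 * k + 1" by (elim oddE)
    have le: "4 * f + 2 \<le> 6 * h" using less.prems(6) 3(2) n by simp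
    show ?thesis
    proof (cases "4 * f + 2 = 6 * h")
      case True
      have one: "honeycomb 1 (2 * h) l"
        using h l_parity 3(2) by unfold_locales auto
      have "h \<ge> 3" using h k by simp
      then obtain vs where "jump_cycle 1 (2 * h) l vs" "int (length vs) = 2 * h"
        using hamiltonian_jump_cycle[OF one odd] by blast
      from insert_columns_iter[OF one this, of 1] show ?thesis using 3(2) True n by auto
    next
      case False
      \<comment> \<open>Here \<open>3 * n = 12 * k + 6\<close>, so \<open>t\<close> is a quarter of
        the number of vertices left out.\<close>
      define t where "t = 3 * k + 1 - f"
      have k1: "k \<ge> 1" and f: "f < 3 * k + 1" using h k False le by auto
      have t: "t \<ge> 1" using f unfolding t_def by linarith
      have n4: "n = 4 * k + 2" using n k by simp
      with k1 3(1) have "6 * k + 6 \<le> n + 2 * f" by linarith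
      then have t': "2 * t + 4 \<le> n" by (simp add: t_def)
      have len: "4 * f + 2 = 3 * n - 4 * t" unfolding t_def n4 by simp
      obtain vs where "jump_cycle m n l vs" "int (length vs) = 3 * n - 4 * t"
        using jump_cycle_strip_column[OF _ t t'] 3(2) by auto
      then show ?thesis unfolding len by blast
    qed
  next
    case 4
    then obtain vs where "jump_cycle m n l vs" "int (length vs) = 2 * n + 2"
      using jump_cycle_strip_bump less.prems(3) by auto
    then show ?thesis using 4(1) by (intro exI[of _ vs]) simp
  next
    case 5
    \<comment> \<open>Removing two columns removes \<open>2 * n = 4 * h\<close> vertices, so
      \<open>f\<close> drops by \<open>h\<close> and stays positive.\<close>
    have hc: "honeycomb (m - 2) n l" using 5 n_pos n_even l_parity by unfold_locales (auto simp: mod_diff_eq)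
    interpret P: honeycomb "m - 2" n l by fact
    have "\<exists>vs. jump_cycle (m - 2) n l vs \<and> int (length vs) = 4 * (f - h) + 2"
    proof (rule less.hyps)
      show "4 * (f - h) + 2 \<le> (m - 2) * n" using less.prems(6) n by (simp add: algebra_simps)
    qed (use hc 5 less.prems n in auto)
    then obtain vs where vs: "jump_cycle (m - 2) n l vs" "int (length vs) = 4 * (f - h) + 2" by blast
    obtain ws where "jump_cycle (m - 2 + 2) n l ws" "int (length ws) = int (length vs) + 2 * n"
      using P.insert_columns[OF vs(1)] by metis
    then show ?thesis using vs(2) n by (intro exI[of _ ws]) simp
  qed
qed

section \<open>One column: spirals of hexagons and shortened columns\<close>

text \<open>The one-column graph unrolled along its column; rows are reduced modulo \<open>n\<close>
  only in \<open>cycle_of_row_walk\<close>.\<close>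

definition row_adj :: "int \<Rightarrow> int \<Rightarrow> int \<Rightarrow> bool" where
  "row_adj l x y \<longleftrightarrow> y = x + 1 \<or> x = y + 1 \<or> (odd x \<and> y = x + l) \<or> (odd y \<and> x = y + l)"

lemma row_adj_sym: "row_adj l x y \<Longrightarrow> row_adj l y x"
  unfolding row_adj_def by blast

lemma walk_upto [simp]: "walk (row_adj l) [a..b]" "walk (row_adj l) (rev [a..b])"
proof -
  show "walk (row_adj l) [a..b]"
    using walk_map_upto[of a b "row_adj l" "\<lambda>x. x"] by (simp add: row_adj_def)
  then show "walk (row_adj l) (rev [a..b])" by (rule walk_rev[rotated]) (rule row_adj_sym)
qed

lemma cycle_of_row_walk:
  assumes "honeycomb 1 n l" "distinct xs" "set xs \<subseteq> {1..n}" "length xs \<ge> 3"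
    "walk (row_adj l) (xs @ [w])" "w mod n = hd xs mod n"
  shows "is_cycle (htg_adj 1 n l) (map (\<lambda>x. (0, x mod n)) xs)"
proof -
  interpret honeycomb 1 n l by fact
  let ?f = "\<lambda>x. (0 :: int, x mod n)"
  have f: "?f x = htg_red 1 n l (0, x)" "?f (x + l) = htg_red 1 n l (1, x)" for x
    by (simp_all add: htg_red_def)
  have chord: "htg_adj 1 n l (?f x) (?f (x + l))" if "odd x" for x
    unfolding f(2) unfolding f(1) by (rule htg_adj_htg_red) (simp add: brick_adj_def brick_step_def that)
  have step: "htg_adj 1 n l (?f x) (?f (x + 1))" for x
    unfolding f(1) by (rule htg_adj_htg_red) (simp add: brick_adj_def brick_step_def)
  have adj: "htg_adj 1 n l (?f x) (?f y)" if "row_adj l x y" for x y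
    using that step[of x] step[of y] chord[of x] chord[of y] htg_adj_sym unfolding row_adj_def by blast
  have inj: "inj_on ?f (set xs)"
  proof (rule inj_onI)
    fix x y assume xy: "x \<in> set xs" "y \<in> set xs" "?f x = ?f y"
    then have "n dvd x - y" by (simp add: mod_eq_dvd_iff)
    moreover have "x \<in> {1..n}" "y \<in> {1..n}" using xy(1,2) assms(3) by blast+
    then have "\<bar>x - y\<bar> < n" by simp linarith
    ultimately show "x = y" using dvd_imp_le_int[of "x - y" n] n_pos by fastforce
  qed
  have "xs \<noteq> []" using assms(4) by auto
  then have hd: "map ?f xs @ [hd (map ?f xs)] = map ?f (xs @ [w])" using assms(6) by (simp add: hd_map)
  show ?thesis
    unfolding is_cycle_iff hd
  proof (intro conjI allI impI)
    fix u v assume "(u, v) \<in> conseq (map ?f (xs @ [w]))"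
    then show "htg_adj 1 n l u v" using adj walkD[OF assms(5)] by (elim conseq_mapE) blast
  qed (use assms inj in \<open>simp_all add: distinct_map\<close>)
qed

text \<open>Boundary of a chain of hexagons winding around the torus in blocks of \<open>k\<close> hexagons: it
  visits exactly the rows \<open>1\<close>, ..., \<open>4 k q + 2\<close>.\<close>

fun spiral :: "int \<Rightarrow> nat \<Rightarrow> int list" where
  "spiral k 0 = [1, 2]"
| "spiral k (Suc q) = rev [4 * k * int q + 2 * k + 2..4 * k * int q + 4 * k + 1] @ spiral k q @
     [4 * k * int q + 3..4 * k * int q + 2 * k + 1] @ [4 * k * int q + 4 * k + 2]"

lemma spiral:
  assumes "k \<ge> 1"
  shows "walk (row_adj (2 * k + 1)) (spiral k q) \<and> distinct (spiral k q) \<and>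
    set (spiral k q) = {1..4 * k * int q + 2} \<and> spiral k q \<noteq> [] \<and>
    hd (spiral k q) = 4 * k * int q + 1 \<and> last (spiral k q) = 4 * k * int q + 2"
proof (induction q)
  case 0 show ?case by (auto simp: row_adj_def)
next
  case (Suc q)
  define z where "z = 4 * k * int q"
  have z: "even z" "z \<ge> 0" using assms by (simp_all add: z_def)
  have z': "4 * k * int (Suc q) = z + 4 * k" by (simp add: z_def algebra_simps)
  have "{z + 2 * k + 2..z + 4 * k + 1} \<union> ({1..z + 2} \<union> ({z + 3..z + 2 * k + 1} \<union> {z + 4 * k + 2})) = {1..z + 4 * k + 2}"
    using assms z by auto
  then show ?case
    using Suc assms z unfolding z' spiral.simps z_def[symmetric]
    by (auto simp: last_rev hd_rev) (auto simp: row_adj_def)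
qed

text \<open>The boundary of \<open>q\<close> full blocks and \<open>c\<close> further hexagons, each
  hexagon adding 4 to the initial 2. Its top row exceeds the number of visited rows by
  \<open>2 * (k - c)\<close>, so a spiral of admissible length may fail to fit into \<open>n\<close>
  rows.\<close>

lemma spiral_cycle:
  assumes "honeycomb 1 n (2 * k + 1)" "k \<ge> 1" "1 \<le> c" "c \<le> k" "4 * k * int q + 2 * c + 2 * k + 2 \<le> n"
    "4 * k * int q + 4 * c + 2 \<le> n"
  obtains vs where "is_cycle (htg_adj 1 n (2 * k + 1)) vs" "int (length vs) = 4 * k * int q + 4 * c + 2"
proof
  define z where "z = 4 * k * int q"
  have z: "even z" "z \<ge> 0" using assms by (simp_all add: z_def)
  note spiral = spiral[OF assms(2), of q, folded z_def]
  let ?a = "rev [z + 2 * k + 2..z + 2 * c + 2 * k + 2]" and ?b = "[z + 3..z + 2 * c + 1]"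
  let ?xs = "?a @ spiral k q @ ?b"
  let ?w = "z + 2 * c + 2 * k + 2"
  show "is_cycle (htg_adj 1 n (2 * k + 1)) (map (\<lambda>x. (0, x mod n)) ?xs)"
  proof (rule cycle_of_row_walk[OF assms(1), where w = ?w])
    show "distinct ?xs" using spiral assms z by auto
    show "set ?xs \<subseteq> {1..n}" using spiral assms z by (auto simp: z_def)
    show "walk (row_adj (2 * k + 1)) (?xs @ [?w])"
      using spiral assms(2-4) z by (auto simp: last_rev hd_rev) (auto simp: row_adj_def)
    show "length ?xs \<ge> 3" using assms by simp
    show "?w mod n = hd ?xs mod n" using assms by (simp add: hd_rev)
  qed
  have "length (spiral k q) = nat (z + 2)"
    using spiral distinct_card[of "spiral k q"] by simp
  then show "int (length (map (\<lambda>x. (0, x mod n)) ?xs)) = 4 * k * int q + 4 * c + 2"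
    using assms z unfolding z_def[symmetric] by simp
qed

text \<open>Two crossing chords at distance \<open>2 d\<close> shorten the column cycle by \<open>4 d - 2\<close> vertices; here
  this is done for \<open>d = 1\<close> and \<open>d = t\<close>.\<close>

lemma shortened_column:
  assumes "honeycomb 1 n l" "l \<ge> 3" "t \<ge> 1" "2 * t \<le> l" "2 * l + 4 + 2 * t \<le> n"
  obtains vs where "is_cycle (htg_adj 1 n l) vs" "int (length vs) = n - 4 * t"
proof
  interpret honeycomb 1 n l by fact
  have odd: "odd l" using l_parity by (simp add: odd_iff_mod_2_eq_one)
  let ?xs = "[1] @ rev [3..l + 1] @ [l + 3..l + 4] @ rev [l + 4 + 2 * t..2 * l + 4] @ [2 * l + 4 + 2 * t..n]"
  let ?w = "n + 1"
  show "is_cycle (htg_adj 1 n l) (map (\<lambda>x. (0, x mod n)) ?xs)"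
  proof (rule cycle_of_row_walk[OF assms(1), where w = ?w])
    show "distinct ?xs" using assms by auto
    show "set ?xs \<subseteq> {1..n}" using assms by auto
    show "walk (row_adj l) (?xs @ [?w])"
      using assms(2-5) odd by (auto simp: last_rev hd_rev) (auto simp: row_adj_def)
    show "length ?xs \<ge> 3" using assms by simp
    show "?w mod n = hd ?xs mod n" using assms by simp
  qed
  show "int (length (map (\<lambda>x. (0, x mod n)) ?xs)) = n - 4 * t"
    using assms by simp
qed

lemma one_column_cycle:
  assumes hc: "honeycomb 1 n l" and n: "odd (n div 2)" and l: "3 \<le> l" "2 * l \<le> n" and f: "1 \<le> f" "4 * f + 2 \<le> n"
  shows "\<exists>vs. is_cycle (htg_adj 1 n l) vs \<and> int (length vs) = 4 * f + 2"
proof -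
  interpret honeycomb 1 n l by fact
  have "odd l" using l_parity by (simp add: odd_iff_mod_2_eq_one)
  then obtain k where k: "l = 2 * k + 1" by (elim oddE)
  obtain h where h: "n = 2 * h" using n_even by blast
  with n obtain r where r: "h = 2 * r + 1" by (auto elim!: oddE)
  have k1: "k \<ge> 1" using k l by simp
  \<comment> \<open>\<open>f\<close> hexagons are split into blocks of \<open>k\<close>. The shift
    by one lets \<open>c\<close> range over \<open>1..k\<close>, so that the last block is never
    empty.\<close>
  define q where "q = nat ((f - 1) div k)"
  define c where "c = (f - 1) mod k + 1"
  have "(f - 1) div k \<ge> 0" using f k1 by (simp add: pos_imp_zdiv_nonneg_iff)
  then have fq: "f = k * int q + c" unfolding q_def c_def using mult_div_mod_eq[of k "f - 1"] by simp
  have c: "1 \<le> c" "c \<le> k"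
    subgoal using k1 by (simp add: c_def)
    subgoal using pos_mod_bound[of k "f - 1"] k1 unfolding c_def by linarith
    done
  have len: "4 * f + 2 = 4 * k * int q + 4 * c + 2" using fq by simp
  show ?thesis
  proof (cases "4 * k * int q + 2 * c + 2 * k + 2 \<le> n")
    case True
    show ?thesis
      using spiral_cycle[of n k c q] hc k k1 c True f(2) len by metis
  next
    case False
    \<comment> \<open>For \<open>q = 0\<close> the top row is at most
      \<open>4 * k + 2 = 2 * l\<close>, which fits.\<close>
    have "q > 0" using False c k l(2) by (cases q) auto
    then have "k * 1 \<le> k * int q" using k1 by (intro mult_left_mono) auto
    then have kq: "4 * k \<le> 4 * k * int q" by simp
    show ?thesis
    proof (cases "4 * f + 2 = n")
      case True
      then show ?thesis using column_cycle(1)[OF hc] f by (intro exI[of _ "vert 0 0 (n - 1)"]) simp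
    next
      case neq: False
      define t where "t = r - f"
      have t: "4 * f + 2 = n - 4 * t" "t \<ge> 1" using neq f(2) h r by (simp_all add: t_def)
      \<comment> \<open>If the spiral does not fit, then \<open>4 * t < 2 * (k - c)\<close>: the
        length is so close to \<open>n\<close> that a slight shortening of the column
        suffices.\<close>
      have "2 * t \<le> l \<and> 2 * l + 4 + 2 * t \<le> n"
        using False kq len t c k by linarith
      then show ?thesis using shortened_column[OF hc l(1) t(2)] t(1) by metis
    qed
  qed
qed

section \<open>Assembling the cases by parity\<close>

lemma cycle_exists:
  assumes hc: "honeycomb m n l" and n: "n \<ge> 4" and l: "m = 1 \<Longrightarrow> l mod n \<noteq> 1 \<and> l mod n \<noteq> n - 1"
    and f: "f \<ge> 1" "4 * f + 2 \<le> m * n"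
  shows "\<exists>vs. is_cycle (htg_adj m n l) vs \<and> int (length vs) = 4 * f + 2"
proof -
  interpret honeycomb m n l by fact
  obtain h where h: "n = 2 * h" using n_even by blast
  have odd_l: "odd l \<longleftrightarrow> odd m" using l_parity by (simp only: even_iff_mod_2_eq_zero)
  consider "m \<ge> 2" "odd m \<longrightarrow> odd h" | "m = 1" "odd h" | "odd m" "even h" using m_pos by fastforce
  then show ?thesis
  proof cases
    case 1
    then show ?thesis using jump_cycle_exists[OF hc 1(1) n _ f] h unfolding jump_cycle_def by auto
  next
    case 2
    \<comment> \<open>Simplicity excludes the residues 1 and \<open>n - 1\<close>, so one of
      \<open>l0\<close> and \<open>n - l0\<close> lies between 3 and \<open>n div 2\<close>.\<close>
    define l0 where "l0 = l mod n"
    have l0: "0 \<le> l0" "l0 < n" "odd l0" "l0 \<noteq> 1" "l0 \<noteq> n - 1" "n dvd l - l0"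
      using n n_even odd_l 2 l by (auto simp: l0_def dvd_mod_iff mod_eq_dvd_iff[symmetric])
    have refl: ?thesis if l': "odd l'" "3 \<le> l'" "2 * l' \<le> n" "n dvd l + l'" for l'
    proof -
      have hc': "honeycomb m n l'" using n n_even 2 l'(1) by unfold_locales (auto simp: odd_iff_mod_2_eq_one)
      obtain vs where "is_cycle (htg_adj m n l') vs" "int (length vs) = 4 * f + 2"
        using one_column_cycle[of n l' f] hc' h 2 l' f by auto
      from reflected_cycle[OF hc hc' l'(4) this(1)] this(2) show ?thesis by (metis length_map)
    qed
    show ?thesis
    proof (cases "2 * l0 \<le> n")
      case False
      show ?thesis
      proof (rule refl[of "n - l0"])
        have "l + (n - l0) = (l - l0) + n" by simp
        then show "n dvd l + (n - l0)" using l0(6) by (simp only: dvd_add_triv_right_iff)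
        show "odd (n - l0)" using l0(3) n_even by simp
        then show "3 \<le> n - l0" using l0(2,5) by presburger
      qed (use False in simp)
    next
      case True
      have "3 \<le> l0" using l0(1,3,4) by presburger
      \<comment> \<open>Reflecting twice replaces \<open>l\<close> by its residue
        \<open>l0\<close>.\<close>
      have hc': "honeycomb m n (- l0)" using n n_even 2 l0(3) by unfold_locales (auto simp: mod2_eq_if)
      have hc'': "honeycomb m n l0" using n n_even 2 l0(3) by unfold_locales (auto simp: odd_iff_mod_2_eq_one)
      obtain vs where vs: "is_cycle (htg_adj m n l0) vs" "int (length vs) = 4 * f + 2"
        using one_column_cycle[of n l0 f] hc'' h 2 \<open>3 \<le> l0\<close> True f by auto
      obtain vs' where vs': "is_cycle (htg_adj m n (- l0)) vs'" "length vs' = length vs"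
        using reflected_cycle[OF hc' hc'' _ vs(1)] by auto
      have "n dvd l + - l0" using l0(6) by simp
      from reflected_cycle[OF hc hc' this vs'(1)] show ?thesis
        using vs(2) vs'(2) by (metis length_map)
    qed
  next
    case 3
    \<comment> \<open>An even \<open>c\<close> makes \<open>gcd c h\<close> even, so the exchanged
      graph has an even number of columns. For \<open>m = 1\<close> the condition \<open>cn\<close>
      keeps these columns from shrinking to two rows.\<close>
    have swap: "\<exists>vs. is_cycle (htg_adj m n (2 * c - m)) vs \<and> int (length vs) = 4 * f + 2"
      if c: "even c" and hc': "honeycomb m n (2 * c - m)" and cn: "m = 1 \<Longrightarrow> \<not> h dvd c" for c
    proof -
      define g where "g = gcd c h"
      have g: "g > 0" "g dvd h" "g dvd c" using n h by (auto simp: g_def)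
      have "even g" using c 3 by (simp add: g_def)
      obtain h1 where h1: "h = g * h1" using g(2) by (elim dvdE)
      have div: "h div g = h1" using h1 g(1) by simp
      have "h1 > 0" using n g(1) zero_less_mult_pos[of g h1] unfolding h h1 by simp
      obtain l' where l': "honeycomb g (2 * (m * h1)) l'"
        "\<And>u v. htg_red g (2 * (m * h1)) l' u = htg_red g (2 * (m * h1)) l' v
          \<longleftrightarrow> htg_red m n (2 * c - m) (brick_swap u) = htg_red m n (2 * c - m) (brick_swap v)"
        using honeycomb_swap[of m h c, folded g_def, unfolded div, folded h] hc' by metis
      have "m * h1 \<noteq> 1"
        using cn g(3) h1 m_pos by (auto simp: zmult_eq_1_iff)
      moreover have "m * h1 > 0" using m_pos \<open>h1 > 0\<close> by simp
      ultimately have four: "4 \<le> 2 * (m * h1)" by linarith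
      have le: "4 * f + 2 \<le> g * (2 * (m * h1))" using f(2) unfolding h h1 by (simp add: algebra_simps)
      have "g \<ge> 2" using \<open>even g\<close> g(1) by presburger
      from jump_cycle_exists[OF l'(1) this four _ f(1) le] \<open>even g\<close>
      obtain vs where "is_cycle (htg_adj g (2 * (m * h1)) l') vs" "int (length vs) = 4 * f + 2"
        unfolding jump_cycle_def by blast
      then show ?thesis
        using cycle_transport[OF hc' l'(1) brick_swap_adj l'(2)] by (metis length_map)
    qed
    obtain c where c: "l = 2 * c - m"
    proof -
      have "even (l + m)" using odd_l by simp
      then obtain c where "l + m = 2 * c" by (elim evenE)
      then show thesis using that[of c] by simp
    qed
    show ?thesis
    proof (cases "even c")
      case True
      have "\<not> h dvd c" if "m = 1"
      proof
        assume "h dvd c"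
        then have "n dvd l - (- 1)" using that unfolding c h by simp
        then have "l mod n = (- 1) mod n" by (simp only: mod_eq_dvd_iff)
        then show False using l[OF that] n by (simp add: zmod_minus1)
      qed
      then show ?thesis using swap[OF True] hc unfolding c by blast
    next
      case False
      \<comment> \<open>Reflection replaces \<open>c\<close> by \<open>m - c\<close>, which is even
        because \<open>m\<close> and \<open>c\<close> are both odd.\<close>
      have l': "2 * (m - c) - m = - l" unfolding c by simp
      have hc': "honeycomb m n (- l)" using m_pos n n_even odd_l by unfold_locales (auto simp: mod2_eq_if)
      have "\<not> h dvd m - c" if "m = 1"
      proof
        assume "h dvd m - c"
        then have "n dvd 2 * (m - c)" unfolding h by (rule mult_dvd_mono[OF dvd_refl])
        then have "n dvd - (2 * (m - c))" by (simp only: dvd_minus_iff)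
        moreover have "- (2 * (m - c)) = l - 1" using that unfolding c by simp
        ultimately have "l mod n = 1 mod n" by (simp only: mod_eq_dvd_iff)
        then show False using l[OF that] n by simp
      qed
      moreover have "even (m - c)" using False 3(1) by simp
      ultimately obtain vs where vs: "is_cycle (htg_adj m n (- l)) vs" "int (length vs) = 4 * f + 2"
        using swap[of "m - c"] hc' unfolding l' by blast
      have "n dvd l + - l" by simp
      from reflected_cycle[OF hc hc' this vs(1)] show ?thesis using vs(2) by (metis length_map)
    qed
  qed
qed

theorem theorem5p2:
  fixes m n l :: int and L :: nat
  assumes "htg_params m n l"
    and "L mod 4 = 2" and "6 \<le> L" and "int L \<le> m * n"
  shows "has_cycle_of_length (htg_vertices m n) (htg_adj m n l) L"
proof -
  have hc: "honeycomb m n l" using assms(1) by unfold_locales (auto simp: htg_params_def)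
  define f where "f = int (L div 4)"
  have "L = 4 * (L div 4) + 2" using assms(2) by presburger
  then have L: "int L = 4 * f + 2" unfolding f_def by linarith
  then have f: "f \<ge> 1" "4 * f + 2 \<le> m * n" using assms(3,4) by auto
  obtain vs where vs: "is_cycle (htg_adj m n l) vs" "int (length vs) = 4 * f + 2"
    using cycle_exists[OF hc _ _ f] assms(1) unfolding htg_params_def by blast
  then have "length vs = L" using L by simp
  with has_cycle_of_length_if_is_cycle[OF vs(1), of "htg_vertices m n"] show ?thesis
    by (auto simp: htg_adj_def)
qed

end
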